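(* Let $F\in H^2(T_{\Gamma_1})$ and let $\alpha=(\alpha_1,\dots,\alpha_n)$ be an $n$-tuple of non-negative integers. Then, with $z=x+iy\in T_{\Gamma_1}$, $$\lim_{|x|\to\infty}\frac{|\langle F,\phi_{\alpha,z}\rangle|}{\|\phi_{\alpha,z}\|}=0$$ uniformly for $y\in\Gamma_1$.
   Context: $\Gamma_1=\{y\in\mathbb R^n: y_1>0,\dots,y_n>0\}$, $T_{\Gamma_1}=\{x+iy: x\in\mathbb R^n,\ y\in\Gamma_1\}\subset\mathbb C^n$. $H^2(T_{\Gamma_1})$ is the space of holomorphic $F$ on $T_{\Gamma_1}$ with $\|F\|^2=\sup_{y\in\Gamma_1}\int_{\mathbb R^n}|F(x+iy)|^2dx<\infty$; it is a Hilbert space with inner product $\langle F,G\rangle=\int_{\mathbb R^n}F(\xi)\overline{G(\xi)}\,d\xi$, where $F(\xi)=\lim_{\eta\in\Gamma_1,\eta\to0}F(\xi+i\eta)$ is the $L^2$ boundary limit. Its reproducing kernel is $K_{\Gamma_1}(w,\overline z)=\prod_{k=1}^n\frac{-1}{2\pi i(w_k-\overline z_k)}$. For $z\in T_{\Gamma_1}$, $$\phi_{\alpha,z}(w)=\frac{\partial^{|\alpha|}K_{\Gamma_1}(w,\overline z)}{\partial\overline z_1^{\alpha_1}\cdots\partial\overline z_n^{\alpha_n}}=\Big(\frac{-1}{2\pi i}\Big)^n\prod_{j=1}^n\frac{\alpha_j!}{(w_j-\overline z_j)^{\alpha_j+1}} .$$ *)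

theory Defs
  imports "HOL-Complex_Analysis.Complex_Analysis"
begin

definition Gamma1 :: "(real ^ 'n::finite) set" where
  "Gamma1 = {y. \<forall>j. 0 < y $ j}"

text \<open>The point \<open>x + iy\<close> of complex \<open>n\<close>-space.\<close>
definition cpoint :: "real ^ 'n::finite \<Rightarrow> real ^ 'n \<Rightarrow> complex ^ 'n" where
  "cpoint x y = (\<chi> j. Complex (x $ j) (y $ j))"

definition tube :: "(real ^ 'n::finite) set \<Rightarrow> (complex ^ 'n) set" where
  "tube B = {cpoint x y | x y. y \<in> B}"

text \<open>Holomorphy in several variables, on an open set: the Frechet derivative exists and is
  complex linear.\<close>
definition holomorphic_vec_on :: "(complex ^ 'n::finite \<Rightarrow> complex) \<Rightarrow> (complex ^ 'n) set \<Rightarrow> bool" where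
  "holomorphic_vec_on F S \<longleftrightarrow>
     (\<forall>z\<in>S. \<exists>F'. (F has_derivative F') (at z) \<and> (\<forall>c v. F' (c *s v) = c * F' v))"

text \<open>The squared norm, possibly infinite. Functions on the tube are represented by total functions
  whose values elsewhere are irrelevant.\<close>
definition H2_sqnorm :: "(complex ^ 'n::finite \<Rightarrow> complex) \<Rightarrow> ennreal" where
  "H2_sqnorm F = (SUP y\<in>Gamma1. \<integral>\<^sup>+ x. ennreal ((cmod (F (cpoint x y)))\<^sup>2) \<partial>lborel)"

definition H2 :: "(complex ^ 'n::finite \<Rightarrow> complex) set" where
  "H2 = {F. holomorphic_vec_on F (tube Gamma1) \<and> H2_sqnorm F < \<infinity>}"

definition H2_norm :: "(complex ^ 'n::finite \<Rightarrow> complex) \<Rightarrow> real" where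
  "H2_norm F = sqrt (enn2real (H2_sqnorm F))"

definition is_L2_boundary_limit ::
    "(complex ^ 'n::finite \<Rightarrow> complex) \<Rightarrow> (real ^ 'n \<Rightarrow> complex) \<Rightarrow> bool" where
  "is_L2_boundary_limit F f \<longleftrightarrow> f \<in> borel_measurable lborel \<and>
     ((\<lambda>\<eta>. \<integral>\<^sup>+ \<xi>. ennreal ((cmod (F (cpoint \<xi> \<eta>) - f \<xi>))\<^sup>2) \<partial>lborel) \<longlongrightarrow> 0) (at 0 within Gamma1)"

text \<open>The \<open>L\<^sup>2\<close> limit is determined only almost everywhere; any representative may be chosen, as
  boundary values are only used under an integral.\<close>
definition boundary_value :: "(complex ^ 'n::finite \<Rightarrow> complex) \<Rightarrow> real ^ 'n \<Rightarrow> complex" where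
  "boundary_value F = (SOME f. is_L2_boundary_limit F f)"

definition H2_inner ::
    "(complex ^ 'n::finite \<Rightarrow> complex) \<Rightarrow> (complex ^ 'n \<Rightarrow> complex) \<Rightarrow> complex" where
  "H2_inner F G = (LINT \<xi>|lborel. boundary_value F \<xi> * cnj (boundary_value G \<xi>))"

text \<open>The second argument stands for the conjugated variable: \<open>H2_kernel w (cnj z)\<close> (componentwise
  conjugate) is the reproducing kernel. It is holomorphic in that argument, so the derivatives
  with respect to the conjugates of the \<open>z\<^sub>k\<close> are ordinary complex partial derivatives in it.\<close>
definition H2_kernel :: "complex ^ 'n::finite \<Rightarrow> complex ^ 'n \<Rightarrow> complex" where
  "H2_kernel w \<zeta> = (\<Prod>k\<in>UNIV. - 1 / (2 * of_real pi * \<i> * (w $ k - \<zeta> $ k)))"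

definition vec_upd :: "'a ^ 'n::finite \<Rightarrow> 'n \<Rightarrow> 'a \<Rightarrow> 'a ^ 'n" where
  "vec_upd \<zeta> k t = (\<chi> j. if j = k then t else \<zeta> $ j)"

text \<open>The \<open>m\<close>-th complex partial derivative in the \<open>k\<close>-th variable.\<close>
definition partial_deriv ::
    "'n::finite \<Rightarrow> nat \<Rightarrow> (complex ^ 'n \<Rightarrow> complex) \<Rightarrow> complex ^ 'n \<Rightarrow> complex" where
  "partial_deriv k m f \<zeta> = (deriv ^^ m) (\<lambda>t. f (vec_upd \<zeta> k t)) (\<zeta> $ k)"

text \<open>The index type carries no order, so the order in which the variables are differentiated is
  arbitrary; for the kernel it is immaterial by \<open>partial_derivs_H2_kernel\<close> below.\<close>
definition mixed_partial ::
    "nat ^ 'n::finite \<Rightarrow> (complex ^ 'n \<Rightarrow> complex) \<Rightarrow> complex ^ 'n \<Rightarrow> complex" where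
  "mixed_partial \<alpha> f =
     foldr (\<lambda>k. partial_deriv k (\<alpha> $ k)) (SOME ks. distinct ks \<and> set ks = UNIV) f"

definition phi :: "nat ^ 'n::finite \<Rightarrow> complex ^ 'n \<Rightarrow> complex ^ 'n \<Rightarrow> complex" where
  "phi \<alpha> z w = mixed_partial \<alpha> (H2_kernel w) (\<chi> k. cnj (z $ k))"

lemma higher_deriv_kernel_factor:
  fixes a c w t :: complex
  assumes "w \<noteq> t"
  shows "(deriv ^^ m) (\<lambda>t. c / (w - t)) t = c * fact m / (w - t) ^ Suc m"
  using assms
proof (induction m arbitrary: t)
  case 0
  then show ?case by simp
next
  case (Suc m)
  have "\<forall>\<^sub>F s in nhds t. s \<in> - {w}"
    using Suc.prems by (intro eventually_nhds_in_open) auto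
  then have "\<forall>\<^sub>F s in nhds t. (deriv ^^ m) (\<lambda>t. c / (w - t)) s = c * fact m / (w - s) ^ Suc m"
    by eventually_elim (use Suc.IH in auto)
  then have "(deriv ^^ Suc m) (\<lambda>t. c / (w - t)) t = deriv (\<lambda>s. c * fact m / (w - s) ^ Suc m) t"
    by (simp add: deriv_cong_ev)
  also have "\<dots> = c * fact (Suc m) / (w - t) ^ Suc (Suc m)"
  proof (rule DERIV_imp_deriv)
    have ne: "w - t \<noteq> 0" using Suc.prems by simp
    have "((\<lambda>s. (w - s) ^ Suc m) has_field_derivative - (of_nat (Suc m) * (w - t) ^ m)) (at t)"
      by (rule derivative_eq_intros refl | simp)+
    from DERIV_divide[OF DERIV_const this, of "c * fact m"]
    have "((\<lambda>s. c * fact m / (w - s) ^ Suc m) has_field_derivative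
            c * (of_nat (Suc m) * fact m) * (w - t) ^ m / ((w - t) ^ m * (w - t) ^ Suc (Suc m))) (at t)"
      using ne by (simp add: mult_ac del: of_nat_Suc)
    then show "((\<lambda>s. c * fact m / (w - s) ^ Suc m) has_field_derivative
            c * fact (Suc m) / (w - t) ^ Suc (Suc m)) (at t)"
      using ne by (simp del: of_nat_Suc power_Suc)
  qed
  finally show ?case .
qed

lemma partial_derivs_H2_kernel:
  fixes \<alpha> :: "nat ^ 'n::finite" and w \<zeta> :: "complex ^ 'n"
  assumes "distinct ks" and "\<And>k. w $ k \<noteq> \<zeta> $ k"
  shows "foldr (\<lambda>k. partial_deriv k (\<alpha> $ k)) ks (H2_kernel w) \<zeta> =
    (\<Prod>k\<in>UNIV. - 1 / (2 * of_real pi * \<i>) *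
       (if k \<in> set ks then fact (\<alpha> $ k) / (w $ k - \<zeta> $ k) ^ Suc (\<alpha> $ k)
        else 1 / (w $ k - \<zeta> $ k)))"
  using assms
proof (induction ks arbitrary: \<zeta>)
  case Nil
  show ?case by (simp add: H2_kernel_def)
next
  case (Cons k ks)
  define g where "g = (\<lambda>ks \<zeta> j. - 1 / (2 * of_real pi * \<i>) *
       (if j \<in> set ks then fact (\<alpha> $ j) / (w $ j - \<zeta> $ j) ^ Suc (\<alpha> $ j)
        else 1 / (w $ j - \<zeta> $ j)))"
  define C where "C = (\<Prod>j\<in>UNIV - {k}. g ks \<zeta> j)"
  let ?c = "- 1 / (2 * of_real pi * \<i>) * C"
  have k: "k \<notin> set ks" and ne: "w $ k \<noteq> \<zeta> $ k" using Cons.prems by auto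
  have "\<forall>\<^sub>F t in nhds (\<zeta> $ k). t \<in> - {w $ k}"
    using ne by (intro eventually_nhds_in_open) auto
  then have ev: "\<forall>\<^sub>F t in nhds (\<zeta> $ k).
      foldr (\<lambda>k. partial_deriv k (\<alpha> $ k)) ks (H2_kernel w) (vec_upd \<zeta> k t) = ?c / (w $ k - t)"
  proof eventually_elim
    case (elim t)
    have "foldr (\<lambda>k. partial_deriv k (\<alpha> $ k)) ks (H2_kernel w) (vec_upd \<zeta> k t) =
          (\<Prod>j\<in>UNIV. g ks (vec_upd \<zeta> k t) j)"
      unfolding g_def by (rule Cons.IH) (use Cons.prems elim in \<open>auto simp: vec_upd_def\<close>)
    also have "\<dots> = g ks (vec_upd \<zeta> k t) k * (\<Prod>j\<in>UNIV - {k}. g ks (vec_upd \<zeta> k t) j)"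
      by (rule prod.remove) auto
    also have "(\<Prod>j\<in>UNIV - {k}. g ks (vec_upd \<zeta> k t) j) = C"
      unfolding C_def by (rule prod.cong) (auto simp: g_def vec_upd_def)
    also have "g ks (vec_upd \<zeta> k t) k * C = ?c / (w $ k - t)"
      using k by (simp add: g_def vec_upd_def)
    finally show ?case .
  qed
  have "foldr (\<lambda>k. partial_deriv k (\<alpha> $ k)) (k # ks) (H2_kernel w) \<zeta> =
        (deriv ^^ (\<alpha> $ k)) (\<lambda>t. ?c / (w $ k - t)) (\<zeta> $ k)"
    unfolding foldr.simps comp_apply partial_deriv_def[of k]
    by (rule higher_deriv_cong_ev[OF ev refl])
  also have "\<dots> = ?c * fact (\<alpha> $ k) / (w $ k - \<zeta> $ k) ^ Suc (\<alpha> $ k)"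
    by (rule higher_deriv_kernel_factor) (rule ne)
  also have "\<dots> = g (k # ks) \<zeta> k * C"
    by (simp add: g_def mult_ac)
  also have "C = (\<Prod>j\<in>UNIV - {k}. g (k # ks) \<zeta> j)"
    unfolding C_def by (rule prod.cong) (auto simp: g_def)
  also have "g (k # ks) \<zeta> k * \<dots> = (\<Prod>j\<in>UNIV. g (k # ks) \<zeta> j)"
    by (rule prod.remove[symmetric]) auto
  finally show ?case unfolding g_def .
qed

lemma phi_eq:
  fixes \<alpha> :: "nat ^ 'n::finite" and w z :: "complex ^ 'n"
  assumes "\<And>k. w $ k \<noteq> cnj (z $ k)"
  shows "phi \<alpha> z w = (- 1 / (2 * of_real pi * \<i>)) ^ CARD('n) *
    (\<Prod>j\<in>UNIV. fact (\<alpha> $ j) / (w $ j - cnj (z $ j)) ^ (\<alpha> $ j + 1))"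
proof -
  define ks :: "'n list" where "ks = (SOME ks. distinct ks \<and> set ks = UNIV)"
  have "\<exists>ks :: 'n list. distinct ks \<and> set ks = UNIV"
    using finite_distinct_list[OF finite_class.finite_UNIV] by blast
  then have ks: "distinct ks" "set ks = UNIV"
    unfolding ks_def by (metis (mono_tags, lifting) someI_ex)+
  have "phi \<alpha> z w = foldr (\<lambda>k. partial_deriv k (\<alpha> $ k)) ks (H2_kernel w) (\<chi> k. cnj (z $ k))"
    by (simp add: phi_def mixed_partial_def ks_def)
  also have "\<dots> = (\<Prod>j\<in>UNIV. - 1 / (2 * of_real pi * \<i>) *
      (fact (\<alpha> $ j) / (w $ j - cnj (z $ j)) ^ (\<alpha> $ j + 1)))"
    by (subst partial_derivs_H2_kernel) (use ks assms in auto)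
  also have "\<dots> = (- 1 / (2 * of_real pi * \<i>)) ^ CARD('n) *
    (\<Prod>j\<in>UNIV. fact (\<alpha> $ j) / (w $ j - cnj (z $ j)) ^ (\<alpha> $ j + 1))"
    by (subst prod.distrib) simp
  finally show ?thesis .
qed

end

theory Submission imports Defs begin

text \<open>Two facts are needed. First, every F in H2 has an L2 boundary value. Shifting the contour in the
  direction \<open>y' - y\<close> shows that the slices \<open>F\<^sub>y = F(\<cdot> + iy)\<close> satisfy
  \<open>\<langle>F\<^sub>y, F\<^sub>y\<^sub>'\<rangle> = N((y + y')/2)\<close> with \<open>N(y) = \<parallel>F\<^sub>y\<parallel>\<^sup>2\<close>. Hence N is midpoint convex; being bounded, it is
  decreasing, so it converges as \<open>y \<rightarrow> 0\<close>, and
  \<open>\<parallel>F\<^sub>y - F\<^sub>y\<^sub>'\<parallel>\<^sup>2 = N(y) + N(y') - 2 N((y + y')/2)\<close> makes the slices Cauchy. Second, the modulus p of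
  \<open>\<phi>\<^sub>\<alpha>\<^sub>,\<^sub>z\<close> on real points grows as any coordinate approaches that of x. If \<open>|x\<^sub>i| \<ge> (2m + 1) R\<close>, then the m
  disjoint translates of the slab \<open>|\<xi>\<^sub>i| < R\<close> towards x each carry at least its share of \<open>\<parallel>p\<parallel>\<^sup>2\<close>, so the
  slab carries at most \<open>\<parallel>p\<parallel>\<^sup>2 / m\<close>, whatever y is. The Cauchy-Schwarz inequality inside and outside the
  slab concludes.\<close>

unbundle no Formal_Power_Series.fps_syntax

subsection \<open>Contour shift\<close>


text \<open>By Tonelli, the bound \<open>M\<close> on the slice integrals times the length of
  \<open>{a..b}\<close> bounds the integral of \<open>cmod (K x t)\<close> over the strip, so Fubini
  applies. \<open>K\<close> is cut off outside the strip; the cut-off is Borel because the strip is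
  closed.\<close>

lemma Fubini_strip:
  fixes K :: "'a::euclidean_space \<Rightarrow> real \<Rightarrow> complex"
  assumes cont: "continuous_on (UNIV \<times> {a..b}) (\<lambda>(x, t). K x t)"
    and bound: "\<And>t. t \<in> {a..b} \<Longrightarrow> (\<integral>\<^sup>+x. ennreal (cmod (K x t)) \<partial>lborel) \<le> ennreal M"
  shows "integrable lborel (\<lambda>x. LINT t:{a..b}|lborel. K x t)"
    and "(LINT x|lborel. (LINT t:{a..b}|lborel. K x t)) = (LINT t:{a..b}|lborel. (LINT x|lborel. K x t))"
proof -
  define g where "g = (\<lambda>p. indicator (UNIV \<times> {a..b}) p *\<^sub>R (case p of (x, t) \<Rightarrow> K x t))"
  have g_eq: "g (x, t) = indicator {a..b} t *\<^sub>R K x t" for x t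
    by (simp add: g_def indicator_def)
  have "g \<in> borel_measurable borel"
    unfolding g_def
    by (intro borel_measurable_continuous_on_indicator cont) (auto intro!: borel_closed closed_Times)
  then have meas: "g \<in> borel_measurable (lborel \<Otimes>\<^sub>M lborel)"
    by (simp add: lborel_prod)
  have int: "integrable (lborel \<Otimes>\<^sub>M lborel) g"
  proof (rule integrableI_bounded[OF meas])
    have "(\<integral>\<^sup>+p. ennreal (cmod (g p)) \<partial>(lborel \<Otimes>\<^sub>M lborel))
        = (\<integral>\<^sup>+t. \<integral>\<^sup>+x. ennreal (cmod (g (x, t))) \<partial>lborel \<partial>lborel)"
      by (rule lborel_pair.nn_integral_snd[symmetric]) (use meas in measurable)
    also have "\<dots> \<le> (\<integral>\<^sup>+t. ennreal M * indicator {a..b} t \<partial>lborel)"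
      by (intro nn_integral_mono) (use bound in \<open>auto simp: g_eq indicator_def\<close>)
    also have "\<dots> < \<infinity>"
      by (simp add: nn_integral_cmult ennreal_mult_less_top emeasure_lborel_Icc_eq)
    finally show "(\<integral>\<^sup>+p. ennreal (cmod (g p)) \<partial>(lborel \<Otimes>\<^sub>M lborel)) < \<infinity>" .
  qed
  show "integrable lborel (\<lambda>x. LINT t:{a..b}|lborel. K x t)"
    using lborel_pair.integrable_fst'[OF int] by (simp add: g_eq set_lebesgue_integral_def)
  have "(LINT t|lborel. (LINT x|lborel. g (x, t))) = (LINT x|lborel. (LINT t|lborel. g (x, t)))"
    by (rule lborel_pair.Fubini_integral) (use int in simp)
  then show "(LINT x|lborel. (LINT t:{a..b}|lborel. K x t)) = (LINT t:{a..b}|lborel. (LINT x|lborel. K x t))"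
    by (simp add: g_eq set_lebesgue_integral_def)
qed

lemma lborel_integral_translation:
  fixes f :: "'a::euclidean_space \<Rightarrow> 'b::{banach, second_countable_topology}"
  assumes [measurable]: "f \<in> borel_measurable borel"
  shows "(LINT x|lborel. f (x + c)) = (LINT x|lborel. f x)"
proof -
  have "(LINT x|lborel. f x) = (LINT x|distr lborel borel ((+) c). f x)"
    by (simp add: lborel_distr_plus)
  also have "\<dots> = (LINT x|lborel. f (c + x))"
    by (rule integral_distr) auto
  finally show ?thesis by (simp add: add.commute)
qed

lemma nn_integral_lborel_translation:
  fixes f :: "'a::euclidean_space \<Rightarrow> ennreal"
  assumes [measurable]: "f \<in> borel_measurable borel"
  shows "(\<integral>\<^sup>+x. f (x + c) \<partial>lborel) = (\<integral>\<^sup>+x. f x \<partial>lborel)"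
proof -
  have "(\<integral>\<^sup>+x. f x \<partial>lborel) = (\<integral>\<^sup>+x. f x \<partial>distr lborel borel ((+) c))"
    by (simp add: lborel_distr_plus)
  also have "\<dots> = (\<integral>\<^sup>+x. f (c + x) \<partial>lborel)"
    by (rule nn_integral_distr) auto
  finally show ?thesis by (simp add: add.commute)
qed

text \<open>Cauchy's theorem for the rectangle with corners 0, 1, 1 + ib, ib. A holomorphic function
  on a convex open set has a primitive, so each side contributes the difference of the primitive at
  its ends; the factor \<open>\<i>\<close> is the derivative of the parametrised vertical
  sides.\<close>

lemma integral_rectangle:
  fixes f :: "complex \<Rightarrow> complex"
  assumes S: "convex S" "open S" and hol: "f holomorphic_on S" and b: "0 \<le> b"
    and inS: "\<And>t s. t \<in> {0..1} \<Longrightarrow> s \<in> {0..b} \<Longrightarrow> Complex t s \<in> S"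
  shows "(LINT t:{0..1}|lborel. f (Complex t 0)) + \<i> * (LINT s:{0..b}|lborel. f (Complex 1 s))
       = \<i> * (LINT s:{0..b}|lborel. f (Complex 0 s)) + (LINT t:{0..1}|lborel. f (Complex t b))"
proof -
  obtain g where g: "\<And>x. x \<in> S \<Longrightarrow> (g has_field_derivative f x) (at x within S)"
    using holomorphic_convex_primitive'[OF S hol] by blast
  have g': "(g has_field_derivative f x) (at x)" if "x \<in> S" for x
    using g[OF that] that S(2) by (simp add: at_within_open_NO_MATCH)
  have contf: "continuous_on S f" using hol by (rule holomorphic_on_imp_continuous_on)
  have hor: "(LINT t:{0..1}|lborel. f (Complex t s)) = g (Complex 1 s) - g (Complex 0 s)"
    if s: "s \<in> {0..b}" for s
    unfolding set_lebesgue_integral_def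
  proof (rule integral_FTC_atLeastAtMost)
    show "((\<lambda>t. g (Complex t s)) has_vector_derivative f (Complex t s)) (at t within {0..1})"
      if "0 \<le> t" "t \<le> 1" for t
    proof -
      have "((\<lambda>t. Complex t s) has_vector_derivative 1) (at t within {0..1})"
        unfolding Complex_eq has_vector_derivative_def
        by (auto intro!: derivative_eq_intros simp: scaleR_conv_of_real)
      from field_vector_diff_chain_within[OF this has_field_derivative_at_within[OF g'[OF inS]]] that s
      show ?thesis by (simp add: o_def)
    qed
    show "continuous_on {0..1} (\<lambda>t. f (Complex t s))"
      by (rule continuous_on_compose2[OF contf])
        (intro continuous_intros, use inS s in auto)
  qed simp
  have ver: "\<i> * (LINT s:{0..b}|lborel. f (Complex t s)) = g (Complex t b) - g (Complex t 0)"
    if t: "t \<in> {0..1}" for t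
  proof -
    have "\<i> * (LINT s:{0..b}|lborel. f (Complex t s)) = (LINT s:{0..b}|lborel. \<i> * f (Complex t s))"
      by simp
    also have "\<dots> = g (Complex t b) - g (Complex t 0)"
      unfolding set_lebesgue_integral_def
    proof (rule integral_FTC_atLeastAtMost[OF b])
      show "((\<lambda>s. g (Complex t s)) has_vector_derivative \<i> * f (Complex t s)) (at s within {0..b})"
        if "0 \<le> s" "s \<le> b" for s
      proof -
        have "((\<lambda>s. Complex t s) has_vector_derivative \<i>) (at s within {0..b})"
          unfolding Complex_eq has_vector_derivative_def
        by (auto intro!: derivative_eq_intros simp: scaleR_conv_of_real)
        from field_vector_diff_chain_within[OF this has_field_derivative_at_within[OF g'[OF inS]]] that t
        show ?thesis by (simp add: o_def)
      qed
      show "continuous_on {0..b} (\<lambda>s. \<i> * f (Complex t s))"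
        by (rule continuous_on_mult_left, rule continuous_on_compose2[OF contf])
          (intro continuous_intros, use inS t in auto)
    qed
    finally show ?thesis .
  qed
  show ?thesis
    using b by (subst (1 2) ver, simp, simp, subst (1 2) hor, auto)
qed

text \<open>The contour shift needs no decay at infinity: the rectangle theorem is integrated over all
  translates of the rectangle, whereupon the two vertical sides give the same contribution.\<close>

lemma integral_vertical_shift:
  fixes \<Phi> :: "'a::euclidean_space \<Rightarrow> complex \<Rightarrow> complex"
  assumes S: "convex S" "open S" and hol: "\<And>x. \<Phi> x holomorphic_on S"
    and cont: "continuous_on (UNIV \<times> S) (\<lambda>(x, \<tau>). \<Phi> x \<tau>)"
    and shift: "\<And>x t s. \<Phi> (x + t *\<^sub>R d) (Complex 0 s) = \<Phi> x (Complex t s)"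
    and b: "0 \<le> b" and inS: "\<And>t s. s \<in> {0..b} \<Longrightarrow> Complex t s \<in> S"
    and bound: "\<And>s. s \<in> {0..b} \<Longrightarrow> (\<integral>\<^sup>+x. ennreal (cmod (\<Phi> x (Complex 0 s))) \<partial>lborel) \<le> ennreal M"
  shows "(LINT x|lborel. \<Phi> x (Complex 0 0)) = (LINT x|lborel. \<Phi> x (Complex 0 b))"
proof -
  have meas[measurable]: "(\<lambda>x. \<Phi> x (Complex t s)) \<in> borel_measurable borel" if "s \<in> {0..b}" for t s
  proof (rule borel_measurable_continuous_onI)
    have "continuous_on UNIV (\<lambda>x. (\<lambda>(x, \<tau>). \<Phi> x \<tau>) (x, Complex t s))"
      by (rule continuous_on_compose2[OF cont]) (intro continuous_intros, use inS that in auto)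
    then show "continuous_on UNIV (\<lambda>x. \<Phi> x (Complex t s))" by simp
  qed
  \<comment> \<open>By \<open>shift\<close>, a horizontal move of the parameter by \<open>t\<close>
    is the translation of \<open>x\<close> by \<open>t *\<^sub>R d\<close>. Translation invariance
    therefore carries the bound on the imaginary axis to every \<open>t\<close>, and likewise the
    integrals in \<open>eq\<close>.\<close>
  have nn: "(\<integral>\<^sup>+x. ennreal (cmod (\<Phi> x (Complex t s))) \<partial>lborel) \<le> ennreal M" if "s \<in> {0..b}" for t s
    using nn_integral_lborel_translation[of "\<lambda>x. ennreal (cmod (\<Phi> x (Complex 0 s)))" "t *\<^sub>R d"]
      bound[OF that] meas[OF that] by (simp add: shift)
  have eq: "(LINT x|lborel. \<Phi> x (Complex t s)) = (LINT x|lborel. \<Phi> x (Complex 0 s))" if "s \<in> {0..b}" for t s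
    using lborel_integral_translation[of "\<lambda>x. \<Phi> x (Complex 0 s)" "t *\<^sub>R d"] meas[OF that]
    by (simp add: shift)
  have ch: "continuous_on (UNIV \<times> {0..1}) (\<lambda>(x, t). \<Phi> x (Complex t s))" if "s \<in> {0..b}" for s
  proof -
    have "continuous_on (UNIV \<times> {0..1}) (\<lambda>p. (\<lambda>(x, \<tau>). \<Phi> x \<tau>) (fst p, Complex (snd p) s))"
      by (rule continuous_on_compose2[OF cont])
        (intro continuous_intros, use inS that in auto)
    then show ?thesis by (simp add: case_prod_unfold)
  qed
  have cv: "continuous_on (UNIV \<times> {0..b}) (\<lambda>(x, s). \<Phi> x (Complex t s))" for t
  proof -
    have "continuous_on (UNIV \<times> {0..b}) (\<lambda>p. (\<lambda>(x, \<tau>). \<Phi> x \<tau>) (fst p, Complex t (snd p)))"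
      by (rule continuous_on_compose2[OF cont])
        (intro continuous_intros, use inS in auto)
    then show ?thesis by (simp add: case_prod_unfold)
  qed
  let ?H = "\<lambda>s x. LINT t:{0..1}|lborel. \<Phi> x (Complex t s)"
  let ?V = "\<lambda>t x. LINT s:{0..b}|lborel. \<Phi> x (Complex t s)"
  \<comment> \<open>The rectangle has width one, so averaging the slice integral, which is the same
    for all \<open>t\<close>, over the horizontal side produces no extra factor.\<close>
  have intH: "integrable lborel (?H s)" and H: "(LINT x|lborel. ?H s x) = (LINT x|lborel. \<Phi> x (Complex 0 s))"
    if s: "s \<in> {0..b}" for s
  proof -
    show "integrable lborel (?H s)"
      by (rule Fubini_strip(1)[where K = "\<lambda>x t. \<Phi> x (Complex t s)", OF ch[OF s]]) (rule nn[OF s])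
    have "(LINT x|lborel. ?H s x) = (LINT t:{0..1}|lborel. (LINT x|lborel. \<Phi> x (Complex t s)))"
      by (rule Fubini_strip(2)[where K = "\<lambda>x t. \<Phi> x (Complex t s)", OF ch[OF s]]) (rule nn[OF s])
    also have "\<dots> = (LINT t:{0..1::real}|lborel. (LINT x|lborel. \<Phi> x (Complex 0 s)))"
      by (rule set_lebesgue_integral_cong) (simp, use eq[OF s] in blast)
    finally show "(LINT x|lborel. ?H s x) = (LINT x|lborel. \<Phi> x (Complex 0 s))"
      by (simp add: set_lebesgue_integral_def)
  qed
  have intV: "integrable lborel (?V t)" for t
    by (rule Fubini_strip(1)[where K = "\<lambda>x s. \<Phi> x (Complex t s)", OF cv]) (rule nn)
  have V: "(LINT x|lborel. ?V t x) = (LINT s:{0..b}|lborel. (LINT x|lborel. \<Phi> x (Complex 0 s)))" for t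
  proof -
    have "(LINT x|lborel. ?V t x) = (LINT s:{0..b}|lborel. (LINT x|lborel. \<Phi> x (Complex t s)))"
      by (rule Fubini_strip(2)[where K = "\<lambda>x s. \<Phi> x (Complex t s)", OF cv]) (rule nn)
    also have "\<dots> = (LINT s:{0..b}|lborel. (LINT x|lborel. \<Phi> x (Complex 0 s)))"
      by (rule set_lebesgue_integral_cong) (simp, use eq in blast)
    finally show ?thesis .
  qed
  have "(LINT x|lborel. ?H 0 x + \<i> * ?V 1 x) = (LINT x|lborel. \<i> * ?V 0 x + ?H b x)"
  proof (rule Bochner_Integration.integral_cong[OF refl])
    show "?H 0 x + \<i> * ?V 1 x = \<i> * ?V 0 x + ?H b x" for x
      by (rule integral_rectangle[OF S hol b]) (rule inS)
  qed
  then have "(LINT x|lborel. ?H 0 x) + \<i> * (LINT x|lborel. ?V 1 x)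
      = \<i> * (LINT x|lborel. ?V 0 x) + (LINT x|lborel. ?H b x)"
    using intH[of 0] intH[of b] intV[of 0] intV[of 1] b by simp
  then show ?thesis
    using b by (simp add: H V)
qed

subsection \<open>Slices of functions in H2\<close>

lemma cpoint_in_tube: "y \<in> B \<Longrightarrow> cpoint x y \<in> tube B"
  by (auto simp: tube_def)

lemma continuous_on_cpoint [continuous_intros]:
  assumes "continuous_on S f" "continuous_on S g"
  shows "continuous_on S (\<lambda>p. cpoint (f p) (g p))"
  unfolding cpoint_def
  by (intro continuous_on_vec_lambda continuous_on_Complex continuous_on_component assms)

lemma holomorphic_vec_on_imp_continuous_on:
  assumes "holomorphic_vec_on F S"
  shows "continuous_on S F"
  using assms unfolding holomorphic_vec_on_def
  by (auto intro!: continuous_at_imp_continuous_on dest!: bspec intro: has_derivative_continuous)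

lemma open_Gamma1: "open (Gamma1 :: (real ^ 'n::finite) set)"
proof -
  have "Gamma1 = (\<Inter>j\<in>UNIV. {y :: real ^ 'n. 0 < y $ j})" by (auto simp: Gamma1_def)
  moreover have "open {y :: real ^ 'n. 0 < y $ j}" for j
    by (intro open_Collect_less continuous_intros)
  ultimately show ?thesis by (metis finite_class.finite_UNIV open_INT)
qed

lemma convex_Gamma1: "convex (Gamma1 :: (real ^ 'n::finite) set)"
  unfolding convex_alt Gamma1_def
proof (intro ballI allI impI, clarsimp)
  fix x y :: "real ^ 'n" and u :: real and j
  assume *: "\<forall>j. 0 < x $ j" "\<forall>j. 0 < y $ j" "0 \<le> u" "u \<le> 1"
  show "0 < (1 - u) * x $ j + u * y $ j"
  proof (cases "u = 0")
    case False
    then have "0 < u * y $ j" "0 \<le> (1 - u) * x $ j" using * less_imp_le[of 0 "x $ j"] by simp_all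
    then show ?thesis by linarith
  qed (use * in simp)
qed

text \<open>With a real direction \<open>d\<close>, the argument of \<open>F\<close> is
  \<open>cpoint x y\<close> plus \<tau> times a fixed vector. Complex linearity of the Frechet
  derivative turns it into a complex derivative in \<tau>, which reduces the contour shift to one
  variable.\<close>

lemma holomorphic_on_complex_line:
  fixes F :: "complex ^ 'n::finite \<Rightarrow> complex"
  assumes "holomorphic_vec_on F (tube B)"
  shows "(\<lambda>\<tau>. F (cpoint (x + Re \<tau> *\<^sub>R d) (y + Im \<tau> *\<^sub>R d))) holomorphic_on {\<tau>. y + Im \<tau> *\<^sub>R d \<in> B}"
proof (rule holomorphic_onI)
  fix \<tau> assume "\<tau> \<in> {\<tau>. y + Im \<tau> *\<^sub>R d \<in> B}"
  define v where "v = (\<chi> j. complex_of_real (d $ j))"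
  have line: "cpoint (x + Re \<sigma> *\<^sub>R d) (y + Im \<sigma> *\<^sub>R d) = cpoint x y + \<sigma> *s v" for \<sigma>
    by (simp add: cpoint_def v_def vec_eq_iff complex_eq_iff)
  obtain F' where F': "(F has_derivative F') (at (cpoint x y + \<tau> *s v))" "\<And>c v. F' (c *s v) = c * F' v"
    using assms \<open>\<tau> \<in> _\<close> cpoint_in_tube[of "y + Im \<tau> *\<^sub>R d" B "x + Re \<tau> *\<^sub>R d"]
    unfolding holomorphic_vec_on_def line[symmetric] by blast
  have "bounded_linear (\<lambda>\<sigma>. \<sigma> *s v)"
    by (intro linear_conv_bounded_linear[THEN iffD1] linearI)
      (simp_all add: vec_eq_iff distrib_right)
  then have "((\<lambda>\<sigma>. cpoint x y + \<sigma> *s v) has_derivative (\<lambda>\<sigma>. \<sigma> *s v)) (at \<tau>)"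
    using has_derivative_add[OF has_derivative_const bounded_linear_imp_has_derivative] by simp
  from has_derivative_compose[OF this F'(1)]
  have "((\<lambda>\<sigma>. F (cpoint x y + \<sigma> *s v)) has_field_derivative F' v) (at \<tau>)"
    by (simp add: has_field_derivative_def F'(2) mult.commute[of _ "F' v"])
  then show "(\<lambda>\<tau>. F (cpoint (x + Re \<tau> *\<^sub>R d) (y + Im \<tau> *\<^sub>R d))) field_differentiable
      at \<tau> within {\<tau>. y + Im \<tau> *\<^sub>R d \<in> B}"
    unfolding line field_differentiable_def
    by (blast intro: has_field_derivative_at_within)
qed

lemma measurable_cnj [measurable]: "cnj \<in> borel_measurable borel"
  by (intro borel_measurable_continuous_onI continuous_intros)

text \<open>Since both factors share the bound \<open>C\<close>, the inequality between arithmetic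
  and geometric mean does the work of Cauchy-Schwarz.\<close>

lemma nn_integral_mult_le:
  fixes u v :: "'a \<Rightarrow> complex"
  assumes [measurable]: "u \<in> borel_measurable M" "v \<in> borel_measurable M"
    and u: "(\<integral>\<^sup>+x. ennreal ((cmod (u x))\<^sup>2) \<partial>M) \<le> ennreal C"
    and v: "(\<integral>\<^sup>+x. ennreal ((cmod (v x))\<^sup>2) \<partial>M) \<le> ennreal C"
  shows "(\<integral>\<^sup>+x. ennreal (cmod (u x * cnj (v x))) \<partial>M) \<le> ennreal C"
proof -
  have half: "ennreal (1/2) * (ennreal a + ennreal b) = ennreal (1/2 * (a + b))" if "0 \<le> a" "0 \<le> b" for a b
    unfolding ennreal_plus[OF that, symmetric] by (rule ennreal_mult[symmetric]) (use that in auto)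
  have "cmod (u x * cnj (v x)) \<le> 1/2 * ((cmod (u x))\<^sup>2 + (cmod (v x))\<^sup>2)" for x
    using sum_squares_bound[of "cmod (u x)" "cmod (v x)"] by (simp add: norm_mult)
  then have "(\<integral>\<^sup>+x. ennreal (cmod (u x * cnj (v x))) \<partial>M)
      \<le> (\<integral>\<^sup>+x. ennreal (1/2) * (ennreal ((cmod (u x))\<^sup>2) + ennreal ((cmod (v x))\<^sup>2)) \<partial>M)"
    by (intro nn_integral_mono, subst half) (auto intro: ennreal_leI)
  also have "\<dots> = ennreal (1/2) * ((\<integral>\<^sup>+x. ennreal ((cmod (u x))\<^sup>2) \<partial>M) + (\<integral>\<^sup>+x. ennreal ((cmod (v x))\<^sup>2) \<partial>M))"
    by (subst nn_integral_cmult, measurable, subst nn_integral_add) auto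
  also have "\<dots> \<le> ennreal (1/2) * (ennreal C + ennreal C)"
    by (intro mult_left_mono add_mono u v) simp
  also have "\<dots> = ennreal C"
  \<comment> \<open>\<open>half\<close> requires nonnegative summands; a negative \<open>C\<close>
    is sent to 0 by \<open>ennreal\<close>.\<close>
  proof (cases "0 \<le> C")
    case True
    then show ?thesis by (subst half) auto
  qed (simp add: ennreal_neg)
  finally show ?thesis .
qed

context
  fixes F :: "complex ^ 'n::finite \<Rightarrow> complex"
  assumes F: "F \<in> H2"
begin

lemma H2_continuous_on: "continuous_on (tube Gamma1) F"
  using F by (auto simp: H2_def intro: holomorphic_vec_on_imp_continuous_on)

lemma H2_slice_measurable: "y \<in> Gamma1 \<Longrightarrow> (\<lambda>x. F (cpoint x y)) \<in> borel_measurable borel"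
  by (intro borel_measurable_continuous_onI continuous_on_compose2[OF H2_continuous_on] continuous_intros)
    (auto intro: cpoint_in_tube)

lemma H2_slice_bound:
  assumes "y \<in> Gamma1"
  shows "(\<integral>\<^sup>+x. ennreal ((cmod (F (cpoint x y)))\<^sup>2) \<partial>lborel) \<le> ennreal (enn2real (H2_sqnorm F))"
proof -
  have "H2_sqnorm F < \<infinity>" using F by (simp add: H2_def)
  then have "ennreal (enn2real (H2_sqnorm F)) = H2_sqnorm F" by simp
  then show ?thesis unfolding H2_sqnorm_def using assms by (auto intro: SUP_upper)
qed

lemma H2_slice_square_integrable:
  assumes "y \<in> Gamma1"
  shows "integrable lborel (\<lambda>x. (cmod (F (cpoint x y)))\<^sup>2)"
proof (rule integrableI_bounded)
  show "(\<lambda>x. (cmod (F (cpoint x y)))\<^sup>2) \<in> borel_measurable lborel"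
    using H2_slice_measurable[OF assms] by measurable
  show "(\<integral>\<^sup>+x. ennreal (norm ((cmod (F (cpoint x y)))\<^sup>2)) \<partial>lborel) < \<infinity>"
    using le_less_trans[OF H2_slice_bound[OF assms]] by simp
qed

lemma H2_slice_inner_integrable:
  assumes "y \<in> Gamma1" "y' \<in> Gamma1"
  shows "integrable lborel (\<lambda>x. F (cpoint x y) * cnj (F (cpoint x y')))"
proof (rule integrableI_bounded)
  note [measurable] = H2_slice_measurable[OF assms(1)] H2_slice_measurable[OF assms(2)]
  show "(\<lambda>x. F (cpoint x y) * cnj (F (cpoint x y'))) \<in> borel_measurable lborel"
    by measurable
  show "(\<integral>\<^sup>+x. ennreal (norm (F (cpoint x y) * cnj (F (cpoint x y')))) \<partial>lborel) < \<infinity>"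
    by (rule le_less_trans[OF nn_integral_mult_le[OF _ _ H2_slice_bound H2_slice_bound]])
      (use assms in auto)
qed

text \<open>The slices behave like the orbit of a semigroup of self-adjoint operators.\<close>

lemma H2_slice_inner:
  assumes y: "y \<in> Gamma1" "y' \<in> Gamma1"
  shows "(LINT x|lborel. F (cpoint x y) * cnj (F (cpoint x y')))
       = of_real (LINT x|lborel. (cmod (F (cpoint x ((1/2) *\<^sub>R (y + y')))))\<^sup>2)"
proof -
  define d where "d = y' - y"
  define f where "f = (\<lambda>(y :: real ^ 'n) x \<tau>. F (cpoint (x + Re \<tau> *\<^sub>R d) (y + Im \<tau> *\<^sub>R d)))"
  \<comment> \<open>The double conjugation keeps the second factor holomorphic in \<tau> and
    reverses its vertical motion. As \<open>Im \<tau>\<close> rises from 0 to 1/2, the heights of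
    the two factors move from \<open>y\<close> and \<open>y'\<close> towards each other and meet at
    the midpoint, where the product is a squared modulus.\<close>
  define \<Phi> where "\<Phi> = (\<lambda>x \<tau>. f y x \<tau> * cnj (f y' x (cnj \<tau>)))"
  \<comment> \<open>\<open>T y e\<close> collects the parameters that keep the height in
    \<open>Gamma1\<close>; \<open>e = - 1\<close> belongs to the factor with conjugated
    parameter.\<close>
  define T where "T = (\<lambda>(y :: real ^ 'n) e. {\<tau>. y + (e * Im \<tau>) *\<^sub>R d \<in> Gamma1})"
  define S where "S = T y 1 \<inter> T y' (- 1)"
  have hol: "holomorphic_vec_on F (tube Gamma1)" using F by (simp add: H2_def)
  have opT: "open (T y e)" for y e
  proof -
    have "T y e = (\<lambda>\<tau>. y + (e * Im \<tau>) *\<^sub>R d) -` Gamma1" by (auto simp: T_def)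
    then show ?thesis by (auto intro!: open_vimage open_Gamma1 continuous_intros)
  qed
  have cvT: "convex (T y e)" for y e
    unfolding convex_alt
  proof (intro ballI allI impI)
    fix a b :: complex and u :: real
    assume ab: "a \<in> T y e" "b \<in> T y e" and u: "0 \<le> u \<and> u \<le> 1"
    have "y + (e * Im ((1 - u) *\<^sub>R a + u *\<^sub>R b)) *\<^sub>R d
        = (1 - u) *\<^sub>R (y + (e * Im a) *\<^sub>R d) + u *\<^sub>R (y + (e * Im b) *\<^sub>R d)"
      by (simp add: algebra_simps)
    also have "\<dots> \<in> Gamma1"
      using convexD_alt[OF convex_Gamma1, of "y + (e * Im a) *\<^sub>R d" "y + (e * Im b) *\<^sub>R d" u] ab u
      by (simp add: T_def)
    finally show "(1 - u) *\<^sub>R a + u *\<^sub>R b \<in> T y e" by (simp add: T_def)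
  qed
  have S: "convex S" "open S"
    unfolding S_def using opT cvT by (auto intro: convex_Int)
  have hol\<Phi>: "\<Phi> x holomorphic_on S" for x
  proof -
    have 1: "f y x holomorphic_on S"
      by (rule holomorphic_on_subset) (use holomorphic_on_complex_line[OF hol] in \<open>auto simp: f_def S_def T_def\<close>)
    have "cnj \<circ> f y' x \<circ> cnj holomorphic_on T y' (- 1)"
      by (rule holomorphic_on_compose_cnj_cnj[OF _ opT], rule holomorphic_on_subset)
        (use holomorphic_on_complex_line[OF hol] in \<open>auto simp: f_def T_def\<close>)
    from holomorphic_on_subset[OF this, of S]
    have 2: "(\<lambda>\<tau>. cnj (f y' x (cnj \<tau>))) holomorphic_on S"
      by (simp add: S_def o_def)
    show ?thesis unfolding \<Phi>_def by (intro holomorphic_on_mult 1 2)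
  qed
  have cont: "continuous_on (UNIV \<times> S) (\<lambda>(x, \<tau>). \<Phi> x \<tau>)"
    unfolding \<Phi>_def f_def case_prod_unfold
    by (intro continuous_intros continuous_on_compose2[OF H2_continuous_on])
      (auto simp: S_def T_def intro: cpoint_in_tube)
  have seg: "y + s *\<^sub>R d \<in> Gamma1" "y' - s *\<^sub>R d \<in> Gamma1" if "s \<in> {0..1/2}" for s
    using convexD_alt[OF convex_Gamma1 y, of s] convexD_alt[OF convex_Gamma1 y(2,1), of s] that
    by (simp_all add: d_def algebra_simps)
  have "(LINT x|lborel. \<Phi> x (Complex 0 0)) = (LINT x|lborel. \<Phi> x (Complex 0 (1/2)))"
  proof (rule integral_vertical_shift[OF S hol\<Phi> cont])
    show "\<Phi> (x + t *\<^sub>R d) (Complex 0 s) = \<Phi> x (Complex t s)" for x t s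
      by (simp add: \<Phi>_def f_def)
    show "Complex t s \<in> S" if "s \<in> {0..1/2}" for t s
      using seg[OF that] by (simp add: S_def T_def)
    show "(\<integral>\<^sup>+x. ennreal (cmod (\<Phi> x (Complex 0 s))) \<partial>lborel) \<le> ennreal (enn2real (H2_sqnorm F))"
      if s: "s \<in> {0..1/2}" for s
      unfolding \<Phi>_def f_def
      using nn_integral_mult_le[OF _ _ H2_slice_bound H2_slice_bound, OF _ _ seg[OF s]]
        H2_slice_measurable seg[OF s] by simp
  qed simp
  moreover have "y + (1/2) *\<^sub>R d = (1/2) *\<^sub>R (y + y')" "y' - (1/2) *\<^sub>R d = (1/2) *\<^sub>R (y + y')"
    by (simp_all add: d_def vec_eq_iff field_simps)
  ultimately show ?thesis
    by (simp add: \<Phi>_def f_def complex_norm_square[symmetric] flip: integral_complex_of_real)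
qed

end

subsection \<open>Boundary values\<close>

text \<open>Convexity makes the increments nondecreasing, so a positive first increment would force
  at least linear growth, past the bound \<open>C\<close>.\<close>

lemma convex_seq_bounded_above_antitone:
  fixes a :: "nat \<Rightarrow> real"
  assumes convex: "\<And>k. 2 * a (Suc k) \<le> a k + a (Suc (Suc k))" and bound: "\<And>k. a k \<le> C"
  shows "a 1 \<le> a 0"
proof (rule ccontr)
  assume "\<not> a 1 \<le> a 0"
  define \<delta> where "\<delta> = a 1 - a 0"
  have step: "\<delta> \<le> a (Suc k) - a k" for k
  proof (induction k)
    case (Suc k)
    then show ?case using convex[of k] by simp
  qed (simp add: \<delta>_def)
  have lower: "a 0 + real k * \<delta> \<le> a k" for k
  proof (induction k)
    case (Suc k)
    then show ?case using step[of k] by (simp add: algebra_simps)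
  qed simp
  obtain k where "C - a 0 < real k * \<delta>"
    using reals_Archimedean3[of \<delta>] \<open>\<not> a 1 \<le> a 0\<close> by (auto simp: \<delta>_def)
  then show False using lower[of k] bound[of k] by simp
qed

text \<open>The function \<open>N\<close> of the outline, as a real number. The Bochner integral
  would give 0 on a slice that is not square integrable, but for \<open>F\<close> in
  \<open>H2\<close> every slice over \<open>Gamma1\<close> is.\<close>

definition slice_energy :: "(complex ^ 'n::finite \<Rightarrow> complex) \<Rightarrow> real ^ 'n \<Rightarrow> real" where
  "slice_energy F y = (LINT x|lborel. (cmod (F (cpoint x y)))\<^sup>2)"

context
  fixes F :: "complex ^ 'n::finite \<Rightarrow> complex"
  assumes F: "F \<in> H2"
begin

lemma slice_energy_le:
  assumes "y \<in> Gamma1"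
  shows "slice_energy F y \<le> enn2real (H2_sqnorm F)"
proof -
  have "ennreal (slice_energy F y) \<le> ennreal (enn2real (H2_sqnorm F))"
    using H2_slice_bound[OF F assms] H2_slice_square_integrable[OF F assms]
    by (simp add: slice_energy_def nn_integral_eq_integral)
  then show ?thesis by (simp add: ennreal_le_iff)
qed

text \<open>Expanding the square leaves a cross term, whose integral \<open>H2_slice_inner\<close>
  evaluates at the midpoint. Nonnegativity of the result is midpoint convexity of the
  energy.\<close>

lemma H2_slice_diff:
  assumes y: "y \<in> Gamma1" "y' \<in> Gamma1"
  shows "(\<integral>\<^sup>+x. ennreal ((cmod (F (cpoint x y) - F (cpoint x y')))\<^sup>2) \<partial>lborel)
       = ennreal (slice_energy F y + slice_energy F y' - 2 * slice_energy F ((1/2) *\<^sub>R (y + y')))" (is ?A)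
    and "2 * slice_energy F ((1/2) *\<^sub>R (y + y')) \<le> slice_energy F y + slice_energy F y'" (is ?B)
proof -
  let ?I = "\<lambda>x. F (cpoint x y) * cnj (F (cpoint x y'))"
  define R where "R = (\<lambda>x. Re (?I x))"
  let ?g = "\<lambda>x. (cmod (F (cpoint x y)))\<^sup>2 + (cmod (F (cpoint x y')))\<^sup>2 - 2 * R x"
  have eq: "(cmod (F (cpoint x y) - F (cpoint x y')))\<^sup>2 = ?g x" for x
    unfolding cmod_power2 by (simp add: R_def power2_eq_square algebra_simps)
  note intI = H2_slice_inner_integrable[OF F y]
  have int: "integrable lborel (\<lambda>x. (cmod (F (cpoint x y)))\<^sup>2)"
    "integrable lborel (\<lambda>x. (cmod (F (cpoint x y')))\<^sup>2)" "integrable lborel R"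
    using H2_slice_square_integrable[OF F y(1)] H2_slice_square_integrable[OF F y(2)] integrable_Re[OF intI]
    by (simp_all only: R_def)
  have Re: "(LINT x|lborel. R x) = slice_energy F ((1/2) *\<^sub>R (y + y'))"
    unfolding R_def integral_Re[OF intI] H2_slice_inner[OF F y] slice_energy_def by simp
  have intg: "integrable lborel ?g"
    using int by simp
  have val: "(LINT x|lborel. ?g x)
      = slice_energy F y + slice_energy F y' - 2 * slice_energy F ((1/2) *\<^sub>R (y + y'))"
    using int Re by (simp add: slice_energy_def)
  have nonneg: "0 \<le> ?g x" for x unfolding eq[symmetric] by simp
  show ?A unfolding eq by (subst nn_integral_eq_integral[OF intg]) (use nonneg val in auto)
  have "0 \<le> (LINT x|lborel. ?g x)" by (intro integral_nonneg_AE AE_I2 nonneg)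
  then show ?B unfolding val by simp
qed

text \<open>The ray from \<open>y\<close> through \<open>y'\<close> never leaves
  \<open>Gamma1\<close>, as no component of \<open>y' - y\<close> is negative. Along its equally
  spaced points the energy is a bounded convex sequence, of which \<open>y\<close> and
  \<open>y'\<close> are the first two members.\<close>

lemma slice_energy_antitone:
  assumes y: "y \<in> Gamma1" and le: "\<And>j. y $ j \<le> y' $ j"
  shows "slice_energy F y' \<le> slice_energy F y"
proof -
  define p where "p = (\<lambda>k::nat. y + real k *\<^sub>R (y' - y))"
  have p: "p k \<in> Gamma1" for k
    using y le by (auto simp: p_def Gamma1_def intro!: add_pos_nonneg mult_nonneg_nonneg)
  have "slice_energy F (p 1) \<le> slice_energy F (p 0)"
  proof (rule convex_seq_bounded_above_antitone)
    show "2 * slice_energy F (p (Suc k)) \<le> slice_energy F (p k) + slice_energy F (p (Suc (Suc k)))" for k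
    proof -
      have "(1/2) *\<^sub>R (p k + p (Suc (Suc k))) = p (Suc k)"
        by (simp add: p_def vec_eq_iff field_simps)
      then show ?thesis using H2_slice_diff(2)[OF p[of k] p[of "Suc (Suc k)"]] by simp
    qed
  qed (rule slice_energy_le[OF p])
  then show ?thesis by (simp add: p_def)
qed

text \<open>Take \<open>y0\<close> with energy within \<open>e / 2\<close> of the supremum
  \<open>L\<close>. Near 0 the midpoint lies below \<open>y0\<close> in every coordinate, so its
  energy also exceeds \<open>L - e / 2\<close>, and the formula of \<open>H2_slice_diff\<close> is
  at most \<open>2 * L - 2 * (L - e / 2) = e\<close>.\<close>

lemma H2_slices_Cauchy:
  assumes "0 < e"
  obtains r where "0 < r" and "\<And>y y'. y \<in> Gamma1 \<Longrightarrow> y' \<in> Gamma1 \<Longrightarrow> norm y < r \<Longrightarrow> norm y' < r \<Longrightarrow>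
    (\<integral>\<^sup>+x. ennreal ((cmod (F (cpoint x y) - F (cpoint x y')))\<^sup>2) \<partial>lborel) \<le> ennreal e"
proof -
  define L where "L = (SUP y\<in>Gamma1. slice_energy F y)"
  have ne: "(\<chi> j. 1) \<in> (Gamma1 :: (real ^ 'n) set)" by (simp add: Gamma1_def)
  have bdd: "bdd_above (slice_energy F ` Gamma1)"
    using slice_energy_le by (auto intro!: bdd_aboveI)
  have upper: "slice_energy F y \<le> L" if "y \<in> Gamma1" for y
    unfolding L_def by (rule cSUP_upper[OF that bdd])
  obtain y0 where y0: "y0 \<in> Gamma1" "L - e / 2 < slice_energy F y0"
    using less_cSUP_iff[OF _ bdd, of "L - e / 2"] ne assms unfolding L_def by force
  \<comment> \<open>Coordinates are bounded by the norm, so every vector of norm below the least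
    coordinate of \<open>y0\<close> lies below \<open>y0\<close> componentwise.\<close>
  define r where "r = Min (range (\<lambda>j. y0 $ j))"
  have r: "0 < r" using y0(1) by (simp add: r_def Gamma1_def)
  have r_le: "r \<le> y0 $ j" for j by (simp add: r_def)
  show thesis
  proof (rule that[OF r])
    fix y y' :: "real ^ 'n"
    assume y: "y \<in> Gamma1" "y' \<in> Gamma1" "norm y < r" "norm y' < r"
    let ?m = "(1/2) *\<^sub>R (y + y')"
    have m: "?m \<in> Gamma1" using y by (auto simp: Gamma1_def add_pos_pos)
    have "?m $ j \<le> y0 $ j" for j
      using component_le_norm_cart[of y j] component_le_norm_cart[of y' j] y(3,4) r_le[of j] by simp
    then have "slice_energy F y0 \<le> slice_energy F ?m" by (rule slice_energy_antitone[OF m])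
    then have "slice_energy F y + slice_energy F y' - 2 * slice_energy F ?m \<le> e"
      using upper[OF y(1)] upper[OF y(2)] y0(2) by simp
    then show "(\<integral>\<^sup>+x. ennreal ((cmod (F (cpoint x y) - F (cpoint x y')))\<^sup>2) \<partial>lborel) \<le> ennreal e"
      unfolding H2_slice_diff(1)[OF y(1,2)] by (rule ennreal_leI)
  qed
qed

end

section \<open>Almost everywhere limits and existence of the boundary value\<close>

text \<open>The core of the Riesz-Fischer argument. Weighting the squared increments by
  \<open>4 ^ k\<close> still leaves integrals summable like \<open>(1/4) ^ k\<close>, so the
  weighted sum is finite almost everywhere. Where it equals \<open>C\<close>, the increments are at
  most \<open>sqrt C * (1/2) ^ k\<close>.\<close>

lemma AE_convergent_of_fast_L2_Cauchy:
  fixes u :: "nat \<Rightarrow> 'a \<Rightarrow> complex"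
  assumes [measurable]: "\<And>k. u k \<in> borel_measurable M"
    and fast: "\<And>k. (\<integral>\<^sup>+x. ennreal ((cmod (u (Suc k) x - u k x))\<^sup>2) \<partial>M) \<le> ennreal ((1/16) ^ k)"
  shows "AE x in M. convergent (\<lambda>k. u k x)"
proof -
  define w where "w = (\<lambda>k x. ennreal (4 ^ k) * ennreal ((cmod (u (Suc k) x - u k x))\<^sup>2))"
  have [measurable]: "w k \<in> borel_measurable M" for k unfolding w_def by measurable
  have "(\<integral>\<^sup>+x. (\<Sum>k. w k x) \<partial>M) = (\<Sum>k. \<integral>\<^sup>+x. w k x \<partial>M)"
    by (rule nn_integral_suminf) measurable
  also have "\<dots> \<le> (\<Sum>k. ennreal ((1/4) ^ k))"
  proof (intro suminf_le)
    fix k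
    have "(\<integral>\<^sup>+x. w k x \<partial>M) \<le> ennreal (4 ^ k) * ennreal ((1/16) ^ k)"
      unfolding w_def by (subst nn_integral_cmult) (auto intro: mult_left_mono fast)
    also have "\<dots> = ennreal (4 ^ k * (1/16) ^ k)" by (rule ennreal_mult[symmetric]) auto
    also have "4 ^ k * (1/16) ^ k = ((1/4) ^ k :: real)" by (simp flip: power_mult_distrib)
    finally show "(\<integral>\<^sup>+x. w k x \<partial>M) \<le> ennreal ((1/4) ^ k)" .
  qed auto
  also have "\<dots> < \<infinity>"
    by (subst suminf_ennreal2) (auto intro: summable_geometric)
  finally have "AE x in M. (\<Sum>k. w k x) \<noteq> \<infinity>"
    by (intro nn_integral_PInf_AE) auto
  then show ?thesis
  proof eventually_elim
    case (elim x)
    define C where "C = enn2real (\<Sum>k. w k x)"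
    have C: "(\<Sum>k. w k x) = ennreal C" using elim by (simp add: C_def less_top)
    have "cmod (u (Suc k) x - u k x) \<le> sqrt C * (1/2) ^ k" for k
    proof -
      have "w k x \<le> (\<Sum>k. w k x)"
        using sum_le_suminf[of "\<lambda>k. w k x" "{k}"] by simp
      then have "ennreal (4 ^ k * (cmod (u (Suc k) x - u k x))\<^sup>2) \<le> ennreal C"
        unfolding C by (simp add: w_def ennreal_mult)
      moreover have "0 \<le> C" by (simp add: C_def)
      ultimately have "4 ^ k * (cmod (u (Suc k) x - u k x))\<^sup>2 \<le> C" by (simp add: ennreal_le_iff)
      moreover have "(2 ^ k)\<^sup>2 = (4 ^ k :: real)" by (simp add: power2_eq_square flip: power_mult_distrib)
      ultimately have "(2 ^ k * cmod (u (Suc k) x - u k x))\<^sup>2 \<le> C"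
        by (simp only: power_mult_distrib)
      then have "2 ^ k * cmod (u (Suc k) x - u k x) \<le> sqrt C" by (rule real_le_rsqrt)
      then show ?thesis by (simp add: power_one_over field_simps)
    qed
    note bound = this
    have geo: "summable (\<lambda>k. sqrt C * (1/2) ^ k)"
      by (rule summable_mult, rule summable_geometric) simp
    have "summable (\<lambda>k. u (Suc k) x - u k x)"
      by (rule summable_comparison_test'[OF geo, of 0]) (rule bound)
    then have "convergent (\<lambda>n. u n x - u 0 x)"
      unfolding summable_iff_convergent by (simp add: sum_lessThan_telescope[of "\<lambda>k. u k x"])
    then show "convergent (\<lambda>k. u k x)"
      by (simp add: convergent_diff_const_right_iff)
  qed
qed

lemma nn_integral_Fatou_AE:
  fixes v :: "nat \<Rightarrow> 'a \<Rightarrow> real"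
  assumes [measurable]: "\<And>k. v k \<in> borel_measurable M"
    and lim: "AE x in M. (\<lambda>k. v k x) \<longlonglongrightarrow> l x"
    and bound: "\<forall>\<^sub>F k in sequentially. (\<integral>\<^sup>+x. ennreal (v k x) \<partial>M) \<le> C"
  shows "(\<integral>\<^sup>+x. ennreal (l x) \<partial>M) \<le> C"
proof -
  have "(\<integral>\<^sup>+x. ennreal (l x) \<partial>M) = (\<integral>\<^sup>+x. liminf (\<lambda>k. ennreal (v k x)) \<partial>M)"
    using lim by (intro nn_integral_cong_AE, eventually_elim)
      (metis lim_imp_Liminf sequentially_bot tendsto_ennrealI)
  also have "\<dots> \<le> liminf (\<lambda>k. \<integral>\<^sup>+x. ennreal (v k x) \<partial>M)"
    by (rule nn_integral_liminf) measurable
  also have "\<dots> \<le> C" by (rule Liminf_le[OF sequentially_bot bound])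
  finally show ?thesis .
qed

text \<open>The candidate is the almost everywhere limit of slices along a fast Cauchy sequence of
  heights. Fatou's lemma then compares it with every slice of small height, which gives the limit
  over all of \<open>Gamma1\<close> and not only along the sequence.\<close>

lemma H2_boundary_limit_exists:
  fixes F :: "complex ^ 'n::finite \<Rightarrow> complex"
  assumes F: "F \<in> H2"
  obtains f where "is_L2_boundary_limit F f"
proof -
  define D where "D = (\<lambda>y y'. \<integral>\<^sup>+x. ennreal ((cmod (F (cpoint x y) - F (cpoint x y')))\<^sup>2) \<partial>lborel)"
  have "\<exists>r>0. \<forall>y\<in>Gamma1. \<forall>y'\<in>Gamma1. norm y < r \<longrightarrow> norm y' < r \<longrightarrow> D y y' \<le> ennreal e" if "0 < e" for e
    by (rule H2_slices_Cauchy[OF F that]) (auto simp: D_def)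
  then have "\<forall>k. \<exists>r>0. \<forall>y\<in>Gamma1. \<forall>y'\<in>Gamma1. norm y < r \<longrightarrow> norm y' < r \<longrightarrow> D y y' \<le> ennreal ((1/16) ^ k)"
    by simp
  then obtain r where r: "\<And>k. 0 < r k"
    "\<And>k y y'. y \<in> Gamma1 \<Longrightarrow> y' \<in> Gamma1 \<Longrightarrow> norm y < r k \<Longrightarrow> norm y' < r k \<Longrightarrow> D y y' \<le> ennreal ((1/16) ^ k)"
    by metis
  \<comment> \<open>The minimum puts the height \<open>\<eta> k\<close> within all radii
    \<open>r 0\<close> to \<open>r k\<close> at once; dividing by twice the norm of the all-ones
    vector makes the inequality strict.\<close>
  define c where "c = (\<lambda>k. Min (r ` {..k}) / (2 * norm (\<chi> j. 1 :: real ^ 'n)))"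
  define \<eta> :: "nat \<Rightarrow> real ^ 'n" where "\<eta> = (\<lambda>k. c k *\<^sub>R (\<chi> j. 1))"
  have one: "0 < norm (\<chi> j. 1 :: real ^ 'n)" by (simp add: vec_eq_iff)
  have cpos: "0 < c k" for k using r(1) one by (simp add: c_def)
  have \<eta>: "\<eta> k \<in> Gamma1" for k using cpos by (simp add: \<eta>_def Gamma1_def)
  have small: "norm (\<eta> k) < r i" if "i \<le> k" for i k
  proof -
    have pos: "0 < Min (r ` {..k})" using r(1) by simp
    then have "norm (\<eta> k) = Min (r ` {..k}) / 2"
      using one by (simp add: \<eta>_def c_def del: Min_gr_iff)
    also have "\<dots> < Min (r ` {..k})" using pos by linarith
    also have "\<dots> \<le> r i" using that by (intro Min_le) auto
    finally show ?thesis .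
  qed
  define u where "u = (\<lambda>k x. F (cpoint x (\<eta> k)))"
  have [measurable]: "u k \<in> borel_measurable lborel" for k
    unfolding u_def using H2_slice_measurable[OF F \<eta>] by simp
  have "D (\<eta> (Suc k)) (\<eta> k) \<le> ennreal ((1/16) ^ k)" for k
    by (intro r(2) \<eta> small) auto
  then have conv: "AE x in lborel. convergent (\<lambda>k. u k x)"
    by (intro AE_convergent_of_fast_L2_Cauchy) (auto simp: D_def u_def H2_slice_measurable[OF F \<eta>])
  \<comment> \<open>Off the set of convergence \<open>lim\<close> takes an unspecified value; that
    set has measure zero.\<close>
  define f where "f = (\<lambda>x. lim (\<lambda>k. u k x))"
  have f[measurable]: "f \<in> borel_measurable lborel" unfolding f_def by measurable
  \<comment> \<open>For \<open>k \<ge> i\<close> both heights lie within \<open>r i\<close>, so the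
    slices at \<open>y\<close> and \<open>\<eta> k\<close> are close; Fatou's lemma lets
    \<open>k\<close> tend to infinity.\<close>
  have est: "(\<integral>\<^sup>+x. ennreal ((cmod (F (cpoint x y) - f x))\<^sup>2) \<partial>lborel) \<le> ennreal ((1/16) ^ i)"
    if y: "y \<in> Gamma1" "norm y < r i" for y i
  proof (rule nn_integral_Fatou_AE)
    show "(\<lambda>x. (cmod (F (cpoint x y) - u k x))\<^sup>2) \<in> borel_measurable lborel" for k
      using H2_slice_measurable[OF F y(1)] by measurable
    show "AE x in lborel. (\<lambda>k. (cmod (F (cpoint x y) - u k x))\<^sup>2) \<longlonglongrightarrow> (cmod (F (cpoint x y) - f x))\<^sup>2"
      using conv by eventually_elim (auto simp: f_def convergent_LIMSEQ_iff intro!: tendsto_intros)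
    show "\<forall>\<^sub>F k in sequentially. (\<integral>\<^sup>+x. ennreal ((cmod (F (cpoint x y) - u k x))\<^sup>2) \<partial>lborel) \<le> ennreal ((1/16) ^ i)"
      using eventually_ge_at_top[of i]
      by eventually_elim (use r(2)[OF y(1) \<eta> y(2) small] in \<open>auto simp: D_def u_def\<close>)
  qed
  have "((\<lambda>y. \<integral>\<^sup>+x. ennreal ((cmod (F (cpoint x y) - f x))\<^sup>2) \<partial>lborel) \<longlongrightarrow> 0) (at 0 within Gamma1)"
  proof (rule order_tendstoI)
    fix a :: ennreal assume "0 < a"
    have "(\<lambda>i. ennreal ((1/16) ^ i)) \<longlonglongrightarrow> ennreal 0"
      by (intro tendsto_ennrealI LIMSEQ_realpow_zero) auto
    then have "\<forall>\<^sub>F i in sequentially. ennreal ((1/16) ^ i) < a"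
      using \<open>0 < a\<close> by (intro order_tendstoD) auto
    then obtain i where i: "ennreal ((1/16) ^ i) < a" by (auto simp: eventually_sequentially)
    show "\<forall>\<^sub>F y in at 0 within Gamma1. (\<integral>\<^sup>+x. ennreal ((cmod (F (cpoint x y) - f x))\<^sup>2) \<partial>lborel) < a"
      unfolding eventually_at
      by (rule exI[of _ "r i"]) (use est[of _ i] r(1)[of i] i in \<open>auto intro: le_less_trans\<close>)
  qed simp
  with f have "is_L2_boundary_limit F f" by (simp add: is_L2_boundary_limit_def)
  then show thesis by (rule that)
qed

text \<open>Fatou's lemma works along sequences, so limits within \<open>Gamma1\<close> are sampled
  along this one.\<close>

lemma Gamma1_sequence:
  obtains \<eta> :: "nat \<Rightarrow> real ^ 'n::finite"
  where "filterlim \<eta> (at 0 within Gamma1) sequentially" and "\<And>k. \<eta> k \<in> Gamma1"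
proof -
  define \<eta> :: "nat \<Rightarrow> real ^ 'n" where "\<eta> = (\<lambda>k. inverse (real (Suc k)) *\<^sub>R (\<chi> j. 1))"
  have \<eta>: "\<eta> k \<in> Gamma1" for k by (simp add: \<eta>_def Gamma1_def)
  moreover have "\<eta> k \<noteq> 0" for k by (simp add: \<eta>_def vec_eq_iff)
  moreover have "\<eta> \<longlonglongrightarrow> 0 *\<^sub>R (\<chi> j. 1)"
    unfolding \<eta>_def by (intro tendsto_scaleR LIMSEQ_inverse_real_of_nat tendsto_const)
  ultimately have "filterlim \<eta> (at 0 within Gamma1) sequentially" by (simp add: filterlim_at)
  then show thesis using \<eta> by (rule that)
qed

lemma boundary_value_H2:
  assumes "F \<in> H2"
  shows "is_L2_boundary_limit F (boundary_value F)"
  using H2_boundary_limit_exists[OF assms] unfolding boundary_value_def by (metis someI_ex)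

text \<open>Some slice has squared distance less than 1 from \<open>f\<close>, and that slice is
  square integrable.\<close>

lemma L2_boundary_limit_square_integrable:
  fixes F :: "complex ^ 'n::finite \<Rightarrow> complex"
  assumes F: "F \<in> H2" and f: "is_L2_boundary_limit F f"
  shows "(\<integral>\<^sup>+\<xi>. ennreal ((cmod (f \<xi>))\<^sup>2) \<partial>lborel) < \<infinity>"
proof -
  have [measurable]: "f \<in> borel_measurable lborel" using f by (simp add: is_L2_boundary_limit_def)
  obtain \<eta> :: "nat \<Rightarrow> real ^ 'n" where \<eta>: "filterlim \<eta> (at 0 within Gamma1) sequentially"
    "\<And>k. \<eta> k \<in> Gamma1" using Gamma1_sequence by blast
  define D where "D = (\<lambda>y. \<integral>\<^sup>+\<xi>. ennreal ((cmod (F (cpoint \<xi> y) - f \<xi>))\<^sup>2) \<partial>lborel)"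
  have "(D \<longlongrightarrow> 0) (at 0 within Gamma1)"
    using f by (simp add: is_L2_boundary_limit_def D_def)
  then have "(\<lambda>k. D (\<eta> k)) \<longlonglongrightarrow> 0" by (rule filterlim_compose[OF _ \<eta>(1)])
  then have "\<forall>\<^sub>F k in sequentially. D (\<eta> k) < 1" by (rule order_tendstoD) simp
  then obtain k where k: "D (\<eta> k) < 1" by (auto simp: eventually_sequentially)
  let ?u = "\<lambda>\<xi>. F (cpoint \<xi> (\<eta> k))"
  have [measurable]: "?u \<in> borel_measurable lborel"
    using H2_slice_measurable[OF F \<eta>(2)] by simp
  have pt: "(cmod (f \<xi>))\<^sup>2 \<le> 2 * (cmod (?u \<xi>))\<^sup>2 + 2 * (cmod (?u \<xi> - f \<xi>))\<^sup>2" for \<xi>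
  proof -
    have "cmod (f \<xi>) \<le> cmod (?u \<xi>) + cmod (?u \<xi> - f \<xi>)"
      using norm_triangle_ineq4[of "?u \<xi>" "?u \<xi> - f \<xi>"] by simp
    then have "(cmod (f \<xi>))\<^sup>2 \<le> (cmod (?u \<xi>) + cmod (?u \<xi> - f \<xi>))\<^sup>2" by (intro power_mono) auto
    also have "\<dots> \<le> 2 * (cmod (?u \<xi>))\<^sup>2 + 2 * (cmod (?u \<xi> - f \<xi>))\<^sup>2"
      using sum_squares_bound[of "cmod (?u \<xi>)" "cmod (?u \<xi> - f \<xi>)"] by (simp add: power2_sum)
    finally show ?thesis .
  qed
  have "(\<integral>\<^sup>+\<xi>. ennreal ((cmod (f \<xi>))\<^sup>2) \<partial>lborel)
      \<le> (\<integral>\<^sup>+\<xi>. ennreal (2 * (cmod (?u \<xi>))\<^sup>2 + 2 * (cmod (?u \<xi> - f \<xi>))\<^sup>2) \<partial>lborel)"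
    by (intro nn_integral_mono ennreal_leI pt)
  also have "\<dots> = (\<integral>\<^sup>+\<xi>. 2 * ennreal ((cmod (?u \<xi>))\<^sup>2) + 2 * ennreal ((cmod (?u \<xi> - f \<xi>))\<^sup>2) \<partial>lborel)"
    by (simp add: ennreal_plus ennreal_mult)
  also have "\<dots> = 2 * (\<integral>\<^sup>+\<xi>. ennreal ((cmod (?u \<xi>))\<^sup>2) \<partial>lborel) + 2 * D (\<eta> k)"
    unfolding D_def by (subst nn_integral_add) (auto simp: nn_integral_cmult)
  also have "\<dots> < \<infinity>"
    using le_less_trans[OF H2_slice_bound[OF F \<eta>(2)[of k]]] less_trans[OF k]
    by (auto simp: ennreal_mult_less_top ennreal_add_less_top)
  finally show ?thesis .
qed

text \<open>Fatou's lemma bounds the squared distance from \<open>p\<close> to \<open>g\<close> by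
  every positive constant. This identifies the representative picked by
  \<open>boundary_value\<close> when an explicit pointwise limit is known.\<close>

lemma L2_boundary_limit_eq_pointwise_limit:
  fixes G :: "complex ^ 'n::finite \<Rightarrow> complex"
  assumes g: "is_L2_boundary_limit G g"
    and meas: "\<And>y. y \<in> Gamma1 \<Longrightarrow> (\<lambda>\<xi>. G (cpoint \<xi> y)) \<in> borel_measurable lborel"
    and p[measurable]: "p \<in> borel_measurable lborel"
    and lim: "\<And>\<xi>. ((\<lambda>y. G (cpoint \<xi> y)) \<longlongrightarrow> p \<xi>) (at 0 within Gamma1)"
  shows "AE \<xi> in lborel. g \<xi> = p \<xi>"
proof -
  have g_meas[measurable]: "g \<in> borel_measurable lborel" using g by (simp add: is_L2_boundary_limit_def)
  obtain \<eta> :: "nat \<Rightarrow> real ^ 'n" where \<eta>: "filterlim \<eta> (at 0 within Gamma1) sequentially"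
    "\<And>k. \<eta> k \<in> Gamma1" using Gamma1_sequence by blast
  note [measurable] = meas[OF \<eta>(2)]
  have "((\<lambda>y. \<integral>\<^sup>+\<xi>. ennreal ((cmod (G (cpoint \<xi> y) - g \<xi>))\<^sup>2) \<partial>lborel) \<longlongrightarrow> 0) (at 0 within Gamma1)"
    using g by (simp add: is_L2_boundary_limit_def)
  then have *: "(\<lambda>k. \<integral>\<^sup>+\<xi>. ennreal ((cmod (G (cpoint \<xi> (\<eta> k)) - g \<xi>))\<^sup>2) \<partial>lborel) \<longlonglongrightarrow> 0"
    by (rule filterlim_compose[OF _ \<eta>(1)])
  let ?I = "\<integral>\<^sup>+\<xi>. ennreal ((cmod (p \<xi> - g \<xi>))\<^sup>2) \<partial>lborel"
  have le: "?I \<le> c" if "0 < c" for c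
  proof (rule nn_integral_Fatou_AE)
    show "AE \<xi> in lborel. (\<lambda>k. (cmod (G (cpoint \<xi> (\<eta> k)) - g \<xi>))\<^sup>2) \<longlonglongrightarrow> (cmod (p \<xi> - g \<xi>))\<^sup>2"
      by (intro AE_I2 tendsto_intros filterlim_compose[OF lim \<eta>(1)])
    show "\<forall>\<^sub>F k in sequentially. (\<integral>\<^sup>+\<xi>. ennreal ((cmod (G (cpoint \<xi> (\<eta> k)) - g \<xi>))\<^sup>2) \<partial>lborel) \<le> c"
      using order_tendstoD(2)[OF * that] by eventually_elim (rule less_imp_le)
  qed measurable
  have "?I = 0"
  proof (rule ccontr)
    assume "?I \<noteq> 0"
    then obtain c where "0 < c" "c < ?I" using dense[of 0 ?I] by (auto simp: zero_less_iff_neq_zero)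
    then show False using le[of c] by simp
  qed
  then have "AE \<xi> in lborel. ennreal ((cmod (p \<xi> - g \<xi>))\<^sup>2) = 0"
    by (subst (asm) nn_integral_0_iff_AE) auto
  then show ?thesis by eventually_elim auto
qed

section \<open>Formula, continuity and monotonicity of \<open>phi\<close> up to the boundary\<close>

lemma cpoint_minus_cnj_cpoint:
  "cpoint \<xi> \<eta> $ j - cnj (cpoint x y $ j) = Complex (\<xi> $ j - x $ j) (\<eta> $ j + y $ j)"
  by (simp add: cpoint_def complex_eq_iff)

lemma phi_cpoint:
  fixes x y \<xi> \<eta> :: "real ^ 'n::finite"
  assumes y: "y \<in> Gamma1" and \<eta>: "\<And>j. 0 \<le> \<eta> $ j"
  shows "phi \<alpha> (cpoint x y) (cpoint \<xi> \<eta>) = (- 1 / (2 * of_real pi * \<i>)) ^ CARD('n) *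
    (\<Prod>j\<in>UNIV. fact (\<alpha> $ j) / Complex (\<xi> $ j - x $ j) (\<eta> $ j + y $ j) ^ (\<alpha> $ j + 1))"
proof -
  have "cpoint \<xi> \<eta> $ j \<noteq> cnj (cpoint x y $ j)" for j
    using y add_nonneg_pos[OF \<eta>[of j], of "y $ j"] cpoint_minus_cnj_cpoint[of \<xi> \<eta> j x y]
    by (auto simp: Gamma1_def complex_eq_iff)
  then show ?thesis by (simp add: phi_eq cpoint_minus_cnj_cpoint)
qed

lemma continuous_on_phi:
  fixes x y :: "real ^ 'n::finite"
  assumes y: "y \<in> Gamma1"
  shows "continuous_on (UNIV \<times> {\<eta>. \<forall>j. 0 \<le> \<eta> $ j}) (\<lambda>(\<xi>, \<eta>). phi \<alpha> (cpoint x y) (cpoint \<xi> \<eta>))"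
proof -
  have ne: "Complex (\<xi> $ j - x $ j) (\<eta> $ j + y $ j) \<noteq> 0" if "\<forall>j. 0 \<le> \<eta> $ j" for \<xi> \<eta> :: "real ^ 'n" and j
    using y add_nonneg_pos[of "\<eta> $ j" "y $ j"] that by (auto simp: Gamma1_def complex_eq_iff)
  have "continuous_on (UNIV \<times> {\<eta>. \<forall>j. 0 \<le> \<eta> $ j})
     (\<lambda>p. (- 1 / (2 * of_real pi * \<i>)) ^ CARD('n) *
    (\<Prod>j\<in>UNIV. fact (\<alpha> $ j) / Complex (fst p $ j - x $ j) (snd p $ j + y $ j) ^ (\<alpha> $ j + 1)))"
    by (intro continuous_intros) (use ne in auto)
  then show ?thesis
    by (rule continuous_on_eq) (auto simp: phi_cpoint[OF y])
qed

text \<open>Each factor is a constant over a power of a modulus that grows with the horizontal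
  distance and with the height. Monotonicity in \<xi> feeds the slab estimate; monotonicity in
  \<eta> lets the boundary function dominate all slices.\<close>

lemma cmod_phi_mono:
  fixes x y \<xi> \<xi>' \<eta> \<eta>' :: "real ^ 'n::finite"
  assumes y: "y \<in> Gamma1" and \<eta>: "\<And>j. 0 \<le> \<eta> $ j" "\<And>j. \<eta> $ j \<le> \<eta>' $ j"
    and \<xi>: "\<And>j. \<bar>\<xi> $ j - x $ j\<bar> \<le> \<bar>\<xi>' $ j - x $ j\<bar>"
  shows "cmod (phi \<alpha> (cpoint x y) (cpoint \<xi>' \<eta>')) \<le> cmod (phi \<alpha> (cpoint x y) (cpoint \<xi> \<eta>))"
proof -
  have \<eta>': "0 \<le> \<eta>' $ j" for j using \<eta>(1)[of j] \<eta>(2)[of j] by simp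
  have le: "cmod (Complex (\<xi> $ j - x $ j) (\<eta> $ j + y $ j)) \<le> cmod (Complex (\<xi>' $ j - x $ j) (\<eta>' $ j + y $ j))" for j
  proof -
    have "(\<xi> $ j - x $ j)\<^sup>2 \<le> (\<xi>' $ j - x $ j)\<^sup>2" using \<xi>[of j] by (simp add: abs_le_square_iff)
    moreover have "(\<eta> $ j + y $ j)\<^sup>2 \<le> (\<eta>' $ j + y $ j)\<^sup>2"
      by (rule power_mono) (use \<eta>(1)[of j] \<eta>(2)[of j] y less_imp_le[of 0 "y $ j"] in \<open>simp_all add: Gamma1_def\<close>)
    ultimately show ?thesis unfolding complex_norm by (intro real_sqrt_le_mono add_mono)
  qed
  have pos: "0 < cmod (Complex (\<xi> $ j - x $ j) (\<eta> $ j + y $ j))" for j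
    using y add_nonneg_pos[OF \<eta>(1)[of j], of "y $ j"] by (auto simp: Gamma1_def complex_eq_iff)
  have ne: "Complex (\<xi>' $ j - x $ j) (\<eta>' $ j + y $ j) \<noteq> 0" for j
    using less_le_trans[OF pos le, of j] by simp
  show ?thesis
    unfolding phi_cpoint[OF y \<eta>(1)] phi_cpoint[OF y \<eta>'] norm_mult prod_norm[symmetric]
      norm_divide[of "fact _"] norm_power[of "Complex _ _"]
    by (intro mult_left_mono prod_mono conjI divide_left_mono power_mono le zero_le_power
        mult_pos_pos zero_less_power pos divide_nonneg_nonneg) (auto simp: ne)
qed

section \<open>Slab estimate and L2 pairing bounds\<close>

text \<open>Translating the slab towards \<open>x\<close> without passing it brings its points no
  farther from \<open>x\<close> in any coordinate, so \<open>h\<close> does not decrease.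
  Disjointness of the \<open>m\<close> translates then bounds the sum of their integrals by the full
  one.\<close>

lemma integral_slab_translates:
  fixes h :: "real ^ 'n::finite \<Rightarrow> ennreal"
  assumes [measurable]: "h \<in> borel_measurable borel"
    and mono: "\<And>\<xi> \<xi>'. (\<And>j. \<bar>\<xi> $ j - x $ j\<bar> \<le> \<bar>\<xi>' $ j - x $ j\<bar>) \<Longrightarrow> h \<xi>' \<le> h \<xi>"
    and R: "0 < R" and far: "(2 * real m + 1) * R \<le> \<bar>x $ i\<bar>"
  shows "of_nat m * (\<integral>\<^sup>+\<xi>. h \<xi> * indicator {\<xi>. \<bar>\<xi> $ i\<bar> < R} \<xi> \<partial>lborel) \<le> (\<integral>\<^sup>+\<xi>. h \<xi> \<partial>lborel)"
proof -
  \<comment> \<open>The step \<open>2 * R\<close> is the width of the slab, which makes the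
    translates disjoint, and \<open>sgn (x $ i)\<close> directs them towards \<open>x\<close>;
    \<open>k = 0\<close> gives the slab itself.\<close>
  define c where "c = (\<lambda>k::nat. axis i (2 * R * real k * sgn (x $ i)) :: real ^ 'n)"
  have c: "c k $ j = (if j = i then 2 * R * real k * sgn (x $ i) else 0)" for k j
    by (simp add: c_def axis_def)
  define B where "B = {\<xi> :: real ^ 'n. \<bar>\<xi> $ i\<bar> < R}"
  define T where "T = (\<lambda>k. {\<xi>. \<xi> - c k \<in> B})"
  have "open B" unfolding B_def by (intro open_Collect_less continuous_intros)
  then have [measurable]: "B \<in> sets borel" by simp
  have [measurable]: "T k \<in> sets borel" for k
  proof -
    have "T k = (\<lambda>\<xi>. \<xi> - c k) -` B" by (auto simp: T_def)
    then show ?thesis using \<open>open B\<close> by (auto intro!: borel_open open_vimage continuous_intros)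
  qed
  have xi: "0 < \<bar>x $ i\<bar>" using R far mult_pos_pos[of "2 * real m + 1" R] by linarith
  have disj: "disjoint_family_on T {..<m}"
    unfolding disjoint_family_on_def
  proof (intro ballI impI)
    fix k l :: nat assume "k \<noteq> l"
    show "T k \<inter> T l = {}"
    proof (rule ccontr)
      assume "T k \<inter> T l \<noteq> {}"
      then obtain \<xi> where "\<bar>\<xi> $ i - c k $ i\<bar> < R" "\<bar>\<xi> $ i - c l $ i\<bar> < R"
        by (auto simp: T_def B_def)
      then have "\<bar>c k $ i - c l $ i\<bar> < 2 * R" by linarith
      moreover have "\<bar>c k $ i - c l $ i\<bar> = 2 * R * \<bar>real k - real l\<bar>"
      proof -
        have "c k $ i - c l $ i = 2 * R * (real k - real l) * sgn (x $ i)" by (simp add: c algebra_simps)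
        then show ?thesis using R xi by (simp add: abs_mult abs_sgn_eq)
      qed
      moreover have "1 \<le> \<bar>real k - real l\<bar>" using \<open>k \<noteq> l\<close> by linarith
      ultimately show False using R by (simp add: mult_less_cancel_left2)
    qed
  qed
  have closer: "h \<xi> \<le> h (\<xi> + c k)" if "\<xi> \<in> B" "k < m" for \<xi> k
  proof (rule mono)
    fix j
    define K where "K = 2 * R * real k"
    \<comment> \<open>The last index is \<open>m - 1\<close>, so \<open>far\<close> leaves a margin
      of \<open>3 * R\<close> between the centre of any translate and \<open>x $ i\<close>, and the
      translate stays on the near side.\<close>
    have "K \<le> 2 * R * (real m - 1)" unfolding K_def using that R by (intro mult_left_mono) auto
    then have "K + 3 * R \<le> \<bar>x $ i\<bar>" using far by (simp add: algebra_simps)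
    moreover have "0 \<le> K" using R by (simp add: K_def)
    moreover have "c k $ j = (if j = i then K * sgn (x $ i) else 0)" by (simp add: c K_def)
    ultimately show "\<bar>(\<xi> + c k) $ j - x $ j\<bar> \<le> \<bar>\<xi> $ j - x $ j\<bar>"
      using that(1) xi R by (cases "0 < x $ i") (auto simp: B_def)
  qed
  have "of_nat m * (\<integral>\<^sup>+\<xi>. h \<xi> * indicator B \<xi> \<partial>lborel) = (\<Sum>k<m. \<integral>\<^sup>+\<xi>. h \<xi> * indicator B \<xi> \<partial>lborel)"
    by simp
  also have "\<dots> \<le> (\<Sum>k<m. \<integral>\<^sup>+\<xi>. h (\<xi> + c k) * indicator (T k) (\<xi> + c k) \<partial>lborel)"
    by (intro sum_mono nn_integral_mono) (auto simp: T_def indicator_def intro: closer)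
  also have "\<dots> = (\<Sum>k<m. \<integral>\<^sup>+\<xi>. h \<xi> * indicator (T k) \<xi> \<partial>lborel)"
    by (intro sum.cong refl nn_integral_lborel_translation[of "\<lambda>\<xi>. h \<xi> * indicator (T _) \<xi>"]) measurable
  also have "\<dots> = (\<integral>\<^sup>+\<xi>. (\<Sum>k<m. h \<xi> * indicator (T k) \<xi>) \<partial>lborel)"
    by (rule nn_integral_sum[symmetric]) measurable
  also have "\<dots> = (\<integral>\<^sup>+\<xi>. h \<xi> * indicator (\<Union>k<m. T k) \<xi> \<partial>lborel)"
    by (simp add: indicator_UN_disjoint[OF _ disj] sum_distrib_left)
  also have "\<dots> \<le> (\<integral>\<^sup>+\<xi>. h \<xi> \<partial>lborel)"
    by (intro nn_integral_mono) (auto simp: indicator_def)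
  finally show ?thesis unfolding B_def .
qed

lemma Cauchy_Schwarz_nn_integral_real:
  fixes a b :: "'a \<Rightarrow> real"
  assumes [measurable]: "a \<in> borel_measurable M" "b \<in> borel_measurable M"
    and nonneg: "\<And>x. 0 \<le> a x" "\<And>x. 0 \<le> b x" "0 \<le> A" "0 \<le> B"
    and A: "(\<integral>\<^sup>+x. ennreal ((a x)\<^sup>2) \<partial>M) \<le> ennreal A"
    and B: "(\<integral>\<^sup>+x. ennreal ((b x)\<^sup>2) \<partial>M) \<le> ennreal B"
  shows "(\<integral>\<^sup>+x. ennreal (a x * b x) \<partial>M) \<le> ennreal (sqrt A * sqrt B)"
proof -
  let ?I = "\<integral>\<^sup>+x. ennreal (a x * b x) \<partial>M"
  have "?I\<^sup>2 = (\<integral>\<^sup>+x. ennreal (a x) * ennreal (b x) \<partial>M)\<^sup>2"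
    using nonneg by (simp add: ennreal_mult)
  also have "\<dots> \<le> (\<integral>\<^sup>+x. (ennreal (a x))\<^sup>2 \<partial>M) * (\<integral>\<^sup>+x. (ennreal (b x))\<^sup>2 \<partial>M)"
    by (rule Cauchy_Schwarz_nn_integral) measurable
  also have "\<dots> \<le> ennreal A * ennreal B"
    using A B nonneg by (intro mult_mono) (auto simp: ennreal_power)
  also have "\<dots> = ennreal (A * B)" using nonneg by (simp add: ennreal_mult)
  finally have sq: "?I\<^sup>2 \<le> ennreal (A * B)" .
  show ?thesis
  proof (cases ?I)
    case (real i)
    then have "ennreal (i\<^sup>2) \<le> ennreal (A * B)" using sq by (simp add: ennreal_power)
    then have "i\<^sup>2 \<le> A * B" using nonneg by (simp add: ennreal_le_iff)
    then have "i \<le> sqrt A * sqrt B" by (simp add: real_le_rsqrt flip: real_sqrt_mult)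
    then show ?thesis using real by (simp add: ennreal_leI)
  next
    case top
    then show ?thesis using sq by (simp add: power2_eq_square top_unique)
  qed
qed

subsection \<open>Pairing with the derivatives of the kernel\<close>

text \<open>Inside the slab all of \<open>f\<close> meets at most the share \<open>Q / m\<close> of
  \<open>p\<close>. Outside it \<open>\<bar>\<xi> $ i\<bar> \<ge> R\<close> forces
  \<open>norm \<xi> \<ge> R\<close>, so only the tail of \<open>f\<close> meets all of
  \<open>p\<close>. Cauchy-Schwarz is applied to each piece.\<close>

lemma L2_pairing_far_le:
  fixes f p :: "real ^ 'n::finite \<Rightarrow> complex"
  assumes meas [measurable]: "f \<in> borel_measurable borel" "p \<in> borel_measurable borel"
    and nonneg: "0 \<le> A" "0 \<le> e" "0 \<le> Q"
    and f: "(\<integral>\<^sup>+\<xi>. ennreal ((cmod (f \<xi>))\<^sup>2) \<partial>lborel) \<le> ennreal A"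
    and tail: "(\<integral>\<^sup>+\<xi>. ennreal (indicator {\<xi>. R \<le> norm \<xi>} \<xi> * (cmod (f \<xi>))\<^sup>2) \<partial>lborel) \<le> ennreal e"
    and p: "(\<integral>\<^sup>+\<xi>. ennreal ((cmod (p \<xi>))\<^sup>2) \<partial>lborel) \<le> ennreal Q"
    and mono: "\<And>\<xi> \<xi>'. (\<And>j. \<bar>\<xi> $ j - x $ j\<bar> \<le> \<bar>\<xi>' $ j - x $ j\<bar>) \<Longrightarrow> cmod (p \<xi>') \<le> cmod (p \<xi>)"
    and R: "0 < R" and m: "0 < m" and far: "(2 * real m + 1) * R \<le> \<bar>x $ i\<bar>"
  shows "cmod (LINT \<xi>|lborel. f \<xi> * cnj (p \<xi>)) \<le> (sqrt (A / real m) + sqrt e) * sqrt Q"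
proof -
  define B where "B = {\<xi> :: real ^ 'n. \<bar>\<xi> $ i\<bar> < R}"
  have "open B" unfolding B_def by (intro open_Collect_less continuous_intros)
  then have [measurable]: "B \<in> sets borel" by simp
  let ?X = "\<integral>\<^sup>+\<xi>. ennreal ((indicator B \<xi> * cmod (p \<xi>))\<^sup>2) \<partial>lborel"
  have "?X = (\<integral>\<^sup>+\<xi>. ennreal ((cmod (p \<xi>))\<^sup>2) * indicator B \<xi> \<partial>lborel)"
    by (intro nn_integral_cong) (auto simp: indicator_def)
  then have "of_nat m * ?X \<le> (\<integral>\<^sup>+\<xi>. ennreal ((cmod (p \<xi>))\<^sup>2) \<partial>lborel)"
    using integral_slab_translates[of "\<lambda>\<xi>. ennreal ((cmod (p \<xi>))\<^sup>2)" x R m i] R far mono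
    by (simp add: B_def ennreal_leI power_mono)
  then have "of_nat m * ?X \<le> ennreal Q" using p by (rule order_trans)
  then have "ennreal (1 / real m) * (of_nat m * ?X) \<le> ennreal (1 / real m) * ennreal Q"
    by (rule mult_left_mono) simp
  moreover have "ennreal (1 / real m) * of_nat m = 1"
    using m by (simp add: ennreal_of_nat_eq_real_of_nat flip: ennreal_mult)
  ultimately have X: "?X \<le> ennreal (Q / real m)"
    using nonneg by (simp add: mult.assoc[symmetric] flip: ennreal_mult)
  have "(\<integral>\<^sup>+\<xi>. ennreal ((indicator (- B) \<xi> * cmod (f \<xi>))\<^sup>2) \<partial>lborel)
      \<le> (\<integral>\<^sup>+\<xi>. ennreal (indicator {\<xi>. R \<le> norm \<xi>} \<xi> * (cmod (f \<xi>))\<^sup>2) \<partial>lborel)"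
    using component_le_norm_cart[of _ i]
    by (intro nn_integral_mono ennreal_leI) (auto simp: indicator_def B_def not_less intro: order_trans)
  then have Y: "(\<integral>\<^sup>+\<xi>. ennreal ((indicator (- B) \<xi> * cmod (f \<xi>))\<^sup>2) \<partial>lborel) \<le> ennreal e"
    using tail by (rule order_trans)
  have "(\<integral>\<^sup>+\<xi>. ennreal (cmod (f \<xi> * cnj (p \<xi>))) \<partial>lborel)
      = (\<integral>\<^sup>+\<xi>. ennreal (cmod (f \<xi>) * (indicator B \<xi> * cmod (p \<xi>)))
           + ennreal ((indicator (- B) \<xi> * cmod (f \<xi>)) * cmod (p \<xi>)) \<partial>lborel)"
    by (intro nn_integral_cong) (auto simp: indicator_def norm_mult)
  also have "\<dots> = (\<integral>\<^sup>+\<xi>. ennreal (cmod (f \<xi>) * (indicator B \<xi> * cmod (p \<xi>))) \<partial>lborel)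
      + (\<integral>\<^sup>+\<xi>. ennreal ((indicator (- B) \<xi> * cmod (f \<xi>)) * cmod (p \<xi>)) \<partial>lborel)"
    by (rule nn_integral_add) measurable
  also have "\<dots> \<le> ennreal (sqrt A * sqrt (Q / real m)) + ennreal (sqrt e * sqrt Q)"
    by (intro add_mono Cauchy_Schwarz_nn_integral_real f X Y p) (use nonneg in auto)
  also have "\<dots> = ennreal (sqrt A * sqrt (Q / real m) + sqrt e * sqrt Q)"
    using nonneg by (simp add: ennreal_plus)
  also have "sqrt A * sqrt (Q / real m) + sqrt e * sqrt Q = (sqrt (A / real m) + sqrt e) * sqrt Q"
    by (simp add: real_sqrt_divide algebra_simps)
  finally have le: "(\<integral>\<^sup>+\<xi>. ennreal (cmod (f \<xi> * cnj (p \<xi>))) \<partial>lborel) \<le> ennreal ((sqrt (A / real m) + sqrt e) * sqrt Q)" .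
  show ?thesis
  \<comment> \<open>The Bochner integral of a non-integrable function is 0, which settles that
    case.\<close>
  proof (cases "integrable lborel (\<lambda>\<xi>. f \<xi> * cnj (p \<xi>))")
    case True
    have "ennreal (cmod (LINT \<xi>|lborel. f \<xi> * cnj (p \<xi>))) \<le> ennreal ((sqrt (A / real m) + sqrt e) * sqrt Q)"
      using integral_norm_bound_ennreal[OF True] le by (rule order_trans)
    then show ?thesis using nonneg by (simp add: ennreal_le_iff)
  qed (use nonneg in \<open>simp add: not_integrable_integral_eq\<close>)
qed

text \<open>Dominated convergence with majorant the squared modulus of \<open>f\<close>: at each
  point the indicators are eventually 0.\<close>

lemma L2_tail_small:
  fixes f :: "'a::euclidean_space \<Rightarrow> complex"
  assumes [measurable]: "f \<in> borel_measurable borel"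
    and fin: "(\<integral>\<^sup>+\<xi>. ennreal ((cmod (f \<xi>))\<^sup>2) \<partial>lborel) < \<infinity>" and e: "0 < e"
  obtains R where "0 < R"
    and "(\<integral>\<^sup>+\<xi>. ennreal (indicator {\<xi>. R \<le> norm \<xi>} \<xi> * (cmod (f \<xi>))\<^sup>2) \<partial>lborel) \<le> ennreal e"
proof -
  have [measurable]: "{\<xi> :: 'a. real k \<le> norm \<xi>} \<in> sets borel" for k by measurable
  have "(\<lambda>k. \<integral>\<^sup>+\<xi>. ennreal (indicator {\<xi>. real k \<le> norm \<xi>} \<xi> * (cmod (f \<xi>))\<^sup>2) \<partial>lborel) \<longlonglongrightarrow> (\<integral>\<^sup>+\<xi>. 0 \<partial>(lborel :: 'a measure))"
  proof (rule nn_integral_dominated_convergence[OF _ _ _ _ fin])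
    show "AE \<xi> in lborel. (\<lambda>k. ennreal (indicator {\<xi>. real k \<le> norm \<xi>} \<xi> * (cmod (f \<xi>))\<^sup>2)) \<longlonglongrightarrow> 0"
    proof (rule AE_I2, rule tendsto_eventually)
      fix \<xi> :: 'a
      obtain k0 where k0: "norm \<xi> < real k0" using reals_Archimedean2 by blast
      show "\<forall>\<^sub>F k in sequentially. ennreal (indicator {\<xi>. real k \<le> norm \<xi>} \<xi> * (cmod (f \<xi>))\<^sup>2) = 0"
        using eventually_ge_at_top[of k0] by eventually_elim (use k0 in \<open>auto simp: indicator_def\<close>)
    qed
  qed (auto simp: indicator_def)
  then have "\<forall>\<^sub>F k in sequentially.
      (\<integral>\<^sup>+\<xi>. ennreal (indicator {\<xi>. real k \<le> norm \<xi>} \<xi> * (cmod (f \<xi>))\<^sup>2) \<partial>lborel) < ennreal e"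
    by (rule order_tendstoD) (use e in simp)
  then have "\<forall>\<^sub>F k in sequentially. 0 < k \<and>
      (\<integral>\<^sup>+\<xi>. ennreal (indicator {\<xi>. real k \<le> norm \<xi>} \<xi> * (cmod (f \<xi>))\<^sup>2) \<partial>lborel) < ennreal e"
    using eventually_gt_at_top[of 0] by eventually_elim simp
  then obtain k where "0 < k"
      "(\<integral>\<^sup>+\<xi>. ennreal (indicator {\<xi>. real k \<le> norm \<xi>} \<xi> * (cmod (f \<xi>))\<^sup>2) \<partial>lborel) < ennreal e"
    by (auto simp: eventually_sequentially)
  then show thesis by (intro that[of "real k"]) auto
qed

section \<open>Boundary function of \<open>phi\<close> and the bound for the quotient\<close>

context
  fixes x y :: "real ^ 'n::finite" and \<alpha> :: "nat ^ 'n"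
  assumes y: "y \<in> Gamma1"
begin

lemma phi_slice_measurable:
  assumes "\<And>j. 0 \<le> \<eta> $ j"
  shows "(\<lambda>\<xi>. phi \<alpha> (cpoint x y) (cpoint \<xi> \<eta>)) \<in> borel_measurable borel"
proof (rule borel_measurable_continuous_onI)
  have "continuous_on UNIV (\<lambda>\<xi>. (\<lambda>(\<xi>, \<eta>). phi \<alpha> (cpoint x y) (cpoint \<xi> \<eta>)) (\<xi>, \<eta>))"
    by (rule continuous_on_compose2[OF continuous_on_phi[OF y]]) (intro continuous_intros, use assms in auto)
  then show "continuous_on UNIV (\<lambda>\<xi>. phi \<alpha> (cpoint x y) (cpoint \<xi> \<eta>))" by simp
qed

lemma phi_boundary_tendsto:
  "((\<lambda>\<eta>. phi \<alpha> (cpoint x y) (cpoint \<xi> \<eta>)) \<longlongrightarrow> phi \<alpha> (cpoint x y) (cpoint \<xi> 0)) (at 0 within Gamma1)"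
proof -
  have "continuous_on {\<eta>. \<forall>j. 0 \<le> \<eta> $ j} (\<lambda>\<eta>. (\<lambda>(\<xi>, \<eta>). phi \<alpha> (cpoint x y) (cpoint \<xi> \<eta>)) (\<xi>, \<eta>))"
    by (rule continuous_on_compose2[OF continuous_on_phi[OF y]]) (intro continuous_intros, auto)
  then have "((\<lambda>\<eta>. phi \<alpha> (cpoint x y) (cpoint \<xi> \<eta>)) \<longlongrightarrow> phi \<alpha> (cpoint x y) (cpoint \<xi> 0))
      (at 0 within {\<eta>. \<forall>j. 0 \<le> \<eta> $ j})"
    by (simp add: continuous_on_def)
  then show ?thesis
    by (rule tendsto_within_subset) (auto simp: Gamma1_def intro: less_imp_le)
qed

text \<open>Fatou's lemma along slices. The norm will stand in the denominator, so a lower bound for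
  it is the direction required.\<close>

lemma phi_boundary_norm_le:
  "(\<integral>\<^sup>+\<xi>. ennreal ((cmod (phi \<alpha> (cpoint x y) (cpoint \<xi> 0)))\<^sup>2) \<partial>lborel) \<le> H2_sqnorm (phi \<alpha> (cpoint x y))"
proof -
  obtain \<eta> :: "nat \<Rightarrow> real ^ 'n" where \<eta>: "filterlim \<eta> (at 0 within Gamma1) sequentially"
    "\<And>k. \<eta> k \<in> Gamma1" using Gamma1_sequence by blast
  have [measurable]: "(\<lambda>\<xi>. phi \<alpha> (cpoint x y) (cpoint \<xi> (\<eta> k))) \<in> borel_measurable borel" for k
    by (rule phi_slice_measurable) (use \<eta>(2)[of k] in \<open>auto simp: Gamma1_def intro: less_imp_le\<close>)
  show ?thesis
  proof (rule nn_integral_Fatou_AE)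
    show "AE \<xi> in lborel. (\<lambda>k. (cmod (phi \<alpha> (cpoint x y) (cpoint \<xi> (\<eta> k))))\<^sup>2)
        \<longlonglongrightarrow> (cmod (phi \<alpha> (cpoint x y) (cpoint \<xi> 0)))\<^sup>2"
      by (intro AE_I2 tendsto_intros filterlim_compose[OF phi_boundary_tendsto \<eta>(1)])
    show "\<forall>\<^sub>F k in sequentially. (\<integral>\<^sup>+\<xi>. ennreal ((cmod (phi \<alpha> (cpoint x y) (cpoint \<xi> (\<eta> k))))\<^sup>2) \<partial>lborel)
        \<le> H2_sqnorm (phi \<alpha> (cpoint x y))"
      unfolding H2_sqnorm_def using \<eta>(2) by (intro always_eventually allI SUP_upper)
  qed measurable
qed

text \<open>Here the boundary function is explicit. By \<open>cmod_phi_mono\<close> its modulus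
  dominates every slice, so twice that modulus majorises the differences and dominated convergence
  gives the L2 limit; uniqueness identifies the chosen representative.\<close>

lemma phi_boundary_value:
  assumes fin: "H2_sqnorm (phi \<alpha> (cpoint x y)) < \<infinity>"
  shows "is_L2_boundary_limit (phi \<alpha> (cpoint x y)) (boundary_value (phi \<alpha> (cpoint x y)))"
    and "AE \<xi> in lborel. boundary_value (phi \<alpha> (cpoint x y)) \<xi> = phi \<alpha> (cpoint x y) (cpoint \<xi> 0)"
proof -
  let ?G = "phi \<alpha> (cpoint x y)"
  let ?p = "\<lambda>\<xi>. ?G (cpoint \<xi> 0)"
  have p[measurable]: "?p \<in> borel_measurable borel" by (rule phi_slice_measurable) simp
  have meas: "(\<lambda>\<xi>. ?G (cpoint \<xi> \<eta>)) \<in> borel_measurable borel" if "\<eta> \<in> Gamma1" for \<eta>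
    by (rule phi_slice_measurable) (use that in \<open>auto simp: Gamma1_def intro: less_imp_le\<close>)
  have p_fin: "(\<integral>\<^sup>+\<xi>. ennreal ((2 * cmod (?p \<xi>))\<^sup>2) \<partial>lborel) < \<infinity>"
    using le_less_trans[OF phi_boundary_norm_le fin]
    by (simp add: power_mult_distrib ennreal_mult nn_integral_cmult ennreal_mult_less_top)
  have "is_L2_boundary_limit ?G ?p"
    unfolding is_L2_boundary_limit_def tendsto_at_iff_sequentially
  proof (intro conjI allI impI)
    fix X :: "nat \<Rightarrow> real ^ 'n"
    assume X: "\<forall>i. X i \<in> Gamma1 - {0}" "X \<longlonglongrightarrow> 0"
    then have X': "filterlim X (at 0 within Gamma1) sequentially" by (simp add: filterlim_at)
    have [measurable]: "(\<lambda>\<xi>. ?G (cpoint \<xi> (X k))) \<in> borel_measurable borel" for k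
      using X(1) by (intro meas) auto
    have "(\<lambda>k. \<integral>\<^sup>+\<xi>. ennreal ((cmod (?G (cpoint \<xi> (X k)) - ?p \<xi>))\<^sup>2) \<partial>lborel) \<longlonglongrightarrow> (\<integral>\<^sup>+\<xi>. 0 \<partial>(lborel :: (real ^ 'n) measure))"
    proof (rule nn_integral_dominated_convergence[OF _ _ _ _ p_fin])
      show "AE \<xi> in lborel. ennreal ((cmod (?G (cpoint \<xi> (X k)) - ?p \<xi>))\<^sup>2) \<le> ennreal ((2 * cmod (?p \<xi>))\<^sup>2)" for k
      proof (rule AE_I2, rule ennreal_leI, rule power_mono)
        fix \<xi>
        have "cmod (?G (cpoint \<xi> (X k))) \<le> cmod (?p \<xi>)"
          by (rule cmod_phi_mono[OF y]) (use X(1) in \<open>auto simp: Gamma1_def intro: less_imp_le\<close>)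
        then show "cmod (?G (cpoint \<xi> (X k)) - ?p \<xi>) \<le> 2 * cmod (?p \<xi>)"
          using norm_triangle_ineq4[of "?G (cpoint \<xi> (X k))" "?p \<xi>"] by simp
      qed simp
      show "AE \<xi> in lborel. (\<lambda>k. ennreal ((cmod (?G (cpoint \<xi> (X k)) - ?p \<xi>))\<^sup>2)) \<longlonglongrightarrow> 0"
      proof (rule AE_I2)
        fix \<xi>
        have "(\<lambda>k. ennreal ((cmod (?G (cpoint \<xi> (X k)) - ?p \<xi>))\<^sup>2)) \<longlonglongrightarrow> ennreal ((cmod (?p \<xi> - ?p \<xi>))\<^sup>2)"
          by (intro tendsto_ennrealI tendsto_intros filterlim_compose[OF phi_boundary_tendsto X'])
        then show "(\<lambda>k. ennreal ((cmod (?G (cpoint \<xi> (X k)) - ?p \<xi>))\<^sup>2)) \<longlonglongrightarrow> 0" by simp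
      qed
    qed measurable
    then show "((\<lambda>\<eta>. \<integral>\<^sup>+\<xi>. ennreal ((cmod (?G (cpoint \<xi> \<eta>) - ?p \<xi>))\<^sup>2) \<partial>lborel) \<circ> X) \<longlonglongrightarrow> 0"
      by (simp add: o_def)
  qed simp
  then show lim: "is_L2_boundary_limit ?G (boundary_value ?G)"
    unfolding boundary_value_def by (rule someI[where P = "is_L2_boundary_limit ?G"])
  show "AE \<xi> in lborel. boundary_value ?G \<xi> = ?p \<xi>"
    using lim by (rule L2_boundary_limit_eq_pointwise_limit) (use meas phi_boundary_tendsto in auto)
qed

text \<open>The bound is free of \<open>y\<close>, and \<open>x\<close> enters only through the
  largeness of one coordinate. This is the source of the uniformity.\<close>

lemma phi_ratio_le:
  assumes F: "F \<in> H2" and nonneg: "0 \<le> A" "0 \<le> e"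
    and A: "(\<integral>\<^sup>+\<xi>. ennreal ((cmod (boundary_value F \<xi>))\<^sup>2) \<partial>lborel) \<le> ennreal A"
    and tail: "(\<integral>\<^sup>+\<xi>. ennreal (indicator {\<xi>. R \<le> norm \<xi>} \<xi> * (cmod (boundary_value F \<xi>))\<^sup>2) \<partial>lborel) \<le> ennreal e"
    and R: "0 < R" "0 < m" "(2 * real m + 1) * R \<le> \<bar>x $ i\<bar>"
  shows "cmod (H2_inner F (phi \<alpha> (cpoint x y))) / H2_norm (phi \<alpha> (cpoint x y)) \<le> sqrt (A / real m) + sqrt e"
\<comment> \<open>Division by 0 gives 0. An infinite \<open>H2_sqnorm\<close> falls under this case
  too, since \<open>enn2real\<close> sends infinity to 0, so the other case has a finite
  norm.\<close>
proof (cases "H2_norm (phi \<alpha> (cpoint x y)) = 0")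
  case True
  then show ?thesis using nonneg by simp
next
  case False
  let ?G = "phi \<alpha> (cpoint x y)" and ?f = "boundary_value F"
  define Q where "Q = enn2real (H2_sqnorm ?G)"
  have fin: "H2_sqnorm ?G < \<infinity>" using False by (cases "H2_sqnorm ?G = top") (auto simp: H2_norm_def less_top)
  have f[measurable]: "?f \<in> borel_measurable borel"
    using boundary_value_H2[OF F] by (simp add: is_L2_boundary_limit_def)
  have p[measurable]: "(\<lambda>\<xi>. ?G (cpoint \<xi> 0)) \<in> borel_measurable borel"
    by (rule phi_slice_measurable) simp
  have [measurable]: "boundary_value ?G \<in> borel_measurable borel"
    using phi_boundary_value(1)[OF fin] by (simp add: is_L2_boundary_limit_def)
  have "H2_inner F ?G = (LINT \<xi>|lborel. ?f \<xi> * cnj (?G (cpoint \<xi> 0)))"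
    unfolding H2_inner_def
  proof (rule integral_cong_AE)
    show "AE \<xi> in lborel. ?f \<xi> * cnj (boundary_value ?G \<xi>) = ?f \<xi> * cnj (?G (cpoint \<xi> 0))"
      using phi_boundary_value(2)[OF fin] by eventually_elim simp
  qed measurable
  also have "cmod \<dots> \<le> (sqrt (A / real m) + sqrt e) * sqrt Q"
  proof (rule L2_pairing_far_le[OF f p nonneg _ A tail _ _ R])
    show "(\<integral>\<^sup>+\<xi>. ennreal ((cmod (?G (cpoint \<xi> 0)))\<^sup>2) \<partial>lborel) \<le> ennreal Q"
      using phi_boundary_norm_le fin by (simp add: Q_def)
    show "cmod (?G (cpoint \<xi>' 0)) \<le> cmod (?G (cpoint \<xi> 0))"
      if "\<And>j. \<bar>\<xi> $ j - x $ j\<bar> \<le> \<bar>\<xi>' $ j - x $ j\<bar>" for \<xi> \<xi>'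
      by (rule cmod_phi_mono[OF y]) (use that in auto)
  qed (simp add: Q_def)
  finally have "cmod (H2_inner F ?G) \<le> (sqrt (A / real m) + sqrt e) * H2_norm ?G"
    by (simp add: H2_norm_def Q_def)
  moreover have "0 < H2_norm ?G" using False by (simp add: H2_norm_def less_le)
  ultimately show ?thesis by (simp add: pos_divide_le_eq)
qed

end

theorem lemma4p5:
  fixes F :: "complex ^ 'n::finite \<Rightarrow> complex" and \<alpha> :: "nat ^ 'n"
  assumes "F \<in> H2"
  shows "uniform_limit Gamma1
           (\<lambda>(x :: real ^ 'n) y. cmod (H2_inner F (phi \<alpha> (cpoint x y))) / H2_norm (phi \<alpha> (cpoint x y)))
           (\<lambda>y. 0) at_infinity"
proof (rule uniform_limitI)
  fix e :: real assume e: "0 < e"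
  let ?f = "boundary_value F"
  have lim: "is_L2_boundary_limit F ?f" by (rule boundary_value_H2[OF assms])
  then have meas: "?f \<in> borel_measurable borel" by (simp add: is_L2_boundary_limit_def)
  have fin: "(\<integral>\<^sup>+\<xi>. ennreal ((cmod (?f \<xi>))\<^sup>2) \<partial>lborel) < \<infinity>"
    by (rule L2_boundary_limit_square_integrable[OF assms lim])
  define A where "A = enn2real (\<integral>\<^sup>+\<xi>. ennreal ((cmod (?f \<xi>))\<^sup>2) \<partial>lborel)"
  have A: "(\<integral>\<^sup>+\<xi>. ennreal ((cmod (?f \<xi>))\<^sup>2) \<partial>lborel) \<le> ennreal A" "0 \<le> A"
    using fin by (simp_all add: A_def)
  \<comment> \<open>Tail and slab each get \<open>e / 3\<close>, leaving room for a strict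
    inequality; the square appears because the tail is measured by a squared norm. Both
    \<open>R\<close> and \<open>m\<close> are chosen before \<open>x\<close> and
    \<open>y\<close>.\<close>
  have "0 < (e / 3)\<^sup>2" using e by simp
  then obtain R where R: "0 < R"
    "(\<integral>\<^sup>+\<xi>. ennreal (indicator {\<xi>. R \<le> norm \<xi>} \<xi> * (cmod (?f \<xi>))\<^sup>2) \<partial>lborel) \<le> ennreal ((e / 3)\<^sup>2)"
    using L2_tail_small[OF meas fin] by blast
  obtain m where m: "A / (e / 3)\<^sup>2 < real m" using reals_Archimedean2 by blast
  moreover have "0 \<le> A / (e / 3)\<^sup>2" using A by simp
  ultimately have "0 < real m" by linarith
  then have m0: "0 < m" by simp
  have "A / real m \<le> (e / 3)\<^sup>2" using m \<open>0 < real m\<close> e by (simp add: field_simps)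
  then have sq: "sqrt (A / real m) \<le> e / 3" using e by (intro real_le_lsqrt) auto
  \<comment> \<open>The norm is at most the sum of the absolute coordinates, so a norm of at least
    \<open>b\<close> forces one coordinate to reach \<open>(2 * real m + 1) * R\<close>.\<close>
  define b where "b = real CARD('n) * ((2 * real m + 1) * R)"
  show "\<forall>\<^sub>F x :: real ^ 'n in at_infinity. \<forall>y\<in>Gamma1.
      dist (cmod (H2_inner F (phi \<alpha> (cpoint x y))) / H2_norm (phi \<alpha> (cpoint x y))) 0 < e"
    unfolding eventually_at_infinity
  proof (intro exI[of _ b] allI impI ballI)
    fix x y :: "real ^ 'n" assume x: "b \<le> norm x" and y: "y \<in> Gamma1"
    have "\<exists>i. (2 * real m + 1) * R \<le> \<bar>x $ i\<bar>"
    proof (rule ccontr)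
      assume "\<not> ?thesis"
      then have "(\<Sum>i\<in>UNIV. \<bar>x $ i\<bar>) < (\<Sum>i\<in>(UNIV :: 'n set). (2 * real m + 1) * R)"
        by (intro sum_strict_mono) (auto simp: not_le)
      then show False using x norm_le_l1_cart[of x] by (simp add: b_def)
    qed
    then obtain i where i: "(2 * real m + 1) * R \<le> \<bar>x $ i\<bar>" by blast
    have "cmod (H2_inner F (phi \<alpha> (cpoint x y))) / H2_norm (phi \<alpha> (cpoint x y))
        \<le> sqrt (A / real m) + sqrt ((e / 3)\<^sup>2)"
      by (rule phi_ratio_le[OF y assms A(2) _ A(1) R(2) R(1) m0 i]) simp
    also have "\<dots> < e" using sq e by simp
    finally show "dist (cmod (H2_inner F (phi \<alpha> (cpoint x y))) / H2_norm (phi \<alpha> (cpoint x y))) 0 < e"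
      by (simp add: H2_norm_def)
  qed
qed

end
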